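(* Let $\Phi:\mathbb{R}^d\to\mathbb{R}$ be a continuous strictly positive definite kernel such that, for some $\sigma>d/2$ and constants $0<c_\Phi\le C_\Phi<\infty$, $$c_\Phi(1+\|\omega\|_2^2)^{-\sigma}\le\widehat\Phi(\omega)\le C_\Phi(1+\|\omega\|_2^2)^{-\sigma},\qquad \omega\in\mathbb{R}^d.$$ Fix $c_0>0$. Then, for every $0\le\alpha\le\tau\le\sigma$, there exists a constant $C>0$, depending only on $d,\sigma,\tau,\alpha,\Phi,c_0$ (in particular independent of $\delta$, $X$, $N$ and $v$), such that $$\|v\|_{H^\tau(\mathbb{R}^d)}\le C\,q_X^{\alpha-\tau}\,\|v\|_{H^\alpha(\mathbb{R}^d)}$$ for every $0<\delta\le1$, every finite set $X=\{x_1,\dots,x_N\}\subset\mathbb{R}^d$ satisfying $q_X\le c_0\delta$, and every $v\in V_{\Phi_\delta,X}$.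
   Context: The Fourier transform is $\widehat f(\omega)=(2\pi)^{-d/2}\int_{\mathbb{R}^d}f(x)e^{-ix^T\omega}\,dx$, extended to $L^2(\mathbb{R}^d)$ in the usual way; $\Phi$ is integrable so that $\widehat\Phi$ is given by this integral. $\|\cdot\|_2$ is the Euclidean norm on $\mathbb{R}^d$. For $0<\delta\le1$, the scaled kernel is $\Phi_\delta(x)=\delta^{-d}\Phi(x/\delta)$. For a finite set $X=\{x_1,\dots,x_N\}$ of (at least two) distinct points, the separation distance is $q_X=\frac12\min_{j\ne k}\|x_j-x_k\|_2$, and $V_{\Phi_\delta,X}=\operatorname{span}\{\Phi_\delta(\cdot-x_j):x_j\in X\}$. For $s\ge0$, the Sobolev norm is $\|w\|_{H^s(\mathbb{R}^d)}^2=(2\pi)^{-d/2}\int_{\mathbb{R}^d}(1+\|\omega\|_2^2)^s|\widehat w(\omega)|^2\,d\omega$. *)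

theory Defs
  imports "HOL-Analysis.Analysis"
begin

definition fourier_integral :: "(real ^ 'n \<Rightarrow> complex) \<Rightarrow> real ^ 'n \<Rightarrow> complex" where
  "fourier_integral f \<omega> =
     of_real ((2 * pi) powr (- real CARD('n) / 2)) *
     (LINT x|lborel. f x * exp (- (\<i> * of_real (x \<bullet> \<omega>))))"

definition fourier_L2_limit :: "(real ^ 'n \<Rightarrow> complex) \<Rightarrow> (real ^ 'n \<Rightarrow> complex) \<Rightarrow> bool" where
  "fourier_L2_limit f g \<longleftrightarrow>
     g \<in> borel_measurable lborel \<and>
     integrable lborel (\<lambda>\<omega>. (cmod (g \<omega>))\<^sup>2) \<and>
     ((\<lambda>R. \<integral>\<^sup>+\<omega>. ennreal ((cmod (fourier_integral (\<lambda>x. indicator (cball 0 R) x * f x) \<omega> - g \<omega>))\<^sup>2) \<partial>lborel)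
        \<longlongrightarrow> 0) (at_top :: real filter)"

text \<open>
  The Fourier transform on \<open>L\<^sup>1 \<union> L\<^sup>2\<close>: the integral for integrable functions, and for other
  square integrable functions the Fourier--Plancherel extension, that is, the limit in \<open>L\<^sup>2\<close>
  of the transforms of the truncations to balls. The limit is determined up to a null set,
  and \<open>SOME\<close> picks a representative.
\<close>

definition fourier :: "(real ^ 'n \<Rightarrow> complex) \<Rightarrow> real ^ 'n \<Rightarrow> complex" where
  "fourier f = (if integrable lborel f then fourier_integral f else (SOME g. fourier_L2_limit f g))"

definition ennreal_sqrt :: "ennreal \<Rightarrow> ennreal" where
  "ennreal_sqrt t = (if t = \<infinity> then \<infinity> else ennreal (sqrt (enn2real t)))"

text \<open>
  The norm is extended-valued, so that a divergent integral gives \<open>\<infinity>\<close> and not the default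
  value 0 of the Bochner integral.
\<close>

definition sobolev_norm :: "real \<Rightarrow> (real ^ 'n \<Rightarrow> complex) \<Rightarrow> ennreal" where
  "sobolev_norm s w =
     ennreal_sqrt (ennreal ((2 * pi) powr (- real CARD('n) / 2)) *
       (\<integral>\<^sup>+\<omega>. ennreal ((1 + (norm \<omega>)\<^sup>2) powr s * (cmod (fourier w \<omega>))\<^sup>2) \<partial>lborel))"

text \<open>
  For a real-valued function, strict positive definiteness means that every matrix
  \<open>(\<Phi> (x\<^sub>j - x\<^sub>k))\<close> over distinct points is symmetric positive definite.
\<close>

definition strictly_positive_definite :: "(real ^ 'n \<Rightarrow> real) \<Rightarrow> bool" where
  "strictly_positive_definite \<Phi> \<longleftrightarrow>
     (\<forall>x. \<Phi> (- x) = \<Phi> x) \<and>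
     (\<forall>X c. finite X \<longrightarrow> (\<exists>x\<in>X. c x \<noteq> 0) \<longrightarrow>
        0 < (\<Sum>x\<in>X. \<Sum>y\<in>X. c x * c y * \<Phi> (x - y)))"

definition scaled_kernel :: "real \<Rightarrow> (real ^ 'n \<Rightarrow> real) \<Rightarrow> real ^ 'n \<Rightarrow> real" where
  "scaled_kernel \<delta> \<Phi> x = \<Phi> (x /\<^sub>R \<delta>) / \<delta> ^ CARD('n)"

text \<open>Only meaningful for finite sets with at least two points.\<close>

definition separation_distance :: "(real ^ 'n) set \<Rightarrow> real" where
  "separation_distance X = Min {norm (x - y) |x y. x \<in> X \<and> y \<in> X \<and> x \<noteq> y} / 2"

text \<open>The real linear span of the translates of \<open>\<Psi>\<close> by the points of a finite set \<open>X\<close>.\<close>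

definition translate_span :: "(real ^ 'n \<Rightarrow> real) \<Rightarrow> (real ^ 'n) set \<Rightarrow> (real ^ 'n \<Rightarrow> real) set" where
  "translate_span \<Psi> X = {v. \<exists>c. v = (\<lambda>x. \<Sum>y\<in>X. c y * \<Psi> (x - y))}"

end

theory Submission
  imports Defs
begin

text \<open>
  The Fourier transform turns a combination \<open>v = (\<Sum>y\<in>X. c y * \<Phi>\<^sub>\<delta> (\<cdot> - y))\<close> into a product: it is
  \<open>\<Phi>hat (\<delta> \<omega>) * P \<omega>\<close>, where \<open>P \<omega> = (\<Sum>y\<in>X. c y * exp (- \<i> y\<bullet>\<omega>))\<close> is an exponential sum. Up to
  constants, \<open>\<parallel>v\<parallel>\<close> in the Sobolev space of order \<open>s\<close> is therefore the square root of the integral of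
  \<open>\<bar>P\<bar>\<^sup>2\<close> against the weight \<open>(1 + \<bar>\<omega>\<bar>\<^sup>2) powr s * (1 + \<delta>\<^sup>2 \<bar>\<omega>\<bar>\<^sup>2) powr (- 2 \<sigma>)\<close>, and the claim
  compares two such integrals.

  On the frequencies \<open>\<bar>\<omega>\<bar> \<le> 1 / q\<close> the ratio of the weights of orders \<open>\<tau>\<close> and \<open>\<alpha>\<close> is at most a multiple of
  \<open>q powr (2 (\<alpha> - \<tau>))\<close>. On the higher ones \<open>\<delta> \<bar>\<omega>\<bar>\<close> is bounded below because \<open>q \<le> c\<^sub>0 \<delta>\<close>, so the weight
  of order \<open>\<tau>\<close> behaves like a multiple of \<open>\<bar>\<omega>\<bar> powr (2 \<tau> - 4 \<sigma>)\<close>, which is integrable there since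
  \<open>2 \<sigma> - \<tau> \<ge> \<sigma> > d / 2\<close>. It remains to bound the resulting integral of \<open>\<bar>P\<bar>\<^sup>2\<close> by the integral over
  an annulus \<open>1 / q \<le> \<bar>\<omega>\<bar> \<le> M / q\<close>, on which the weight of order \<open>\<alpha>\<close> is comparable to a constant.

  Both sides are compared with \<open>\<Sum>\<bar>c y\<bar>\<^sup>2\<close>, and this is where the separation of the points enters,
  through Ingham-type inequalities for \<open>P\<close>. They come from one exact identity
  (\<open>nn_integral_fejer_box_expsum\<close>): the transform of the kernel \<open>(sin t / t)\<^sup>2\<close> vanishes outside
  \<open>[-2, 2]\<close>, so the exponentials with frequencies at distance at least 2 in some coordinate are
  orthogonal in \<open>L\<^sup>2\<close> weighted with the tensor product of these kernels. Since moving the kernel only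
  changes the phases of the coefficients, averaging over its centre gives the upper bound
  \<open>nn_integral_weight_expsum_le\<close> for every weight that varies slowly at scale 1. This bound shows in
  particular that the tails of the kernel carry little mass, which yields the lower bound
  \<open>expsum_ball_lower_bound\<close> on balls with arbitrary centre and a fixed radius.
\<close>

section \<open>The one-dimensional Fejer kernel\<close>

lemma nn_integral_bracket_powr_finite:
  fixes r :: real
  assumes r: "1 / 2 < r"
  shows "(\<integral>\<^sup>+x. ennreal ((1 + x\<^sup>2) powr (- r)) \<partial>(lborel :: real measure)) < \<infinity>"
proof -
  let ?t = "\<lambda>x::real. ennreal (x powr (- (2 * r)) * indicator {1..} x)"
  have "((\<lambda>x::real. x powr (- (2 * r))) has_integral - (1 powr (- (2 * r) + 1)) / (- (2 * r) + 1)) {1..}"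
    using r by (intro has_integral_powr_to_inf) auto
  then have tail: "(\<integral>\<^sup>+x. ?t x \<partial>lborel) < \<infinity>"
    using nn_integral_has_integral_lebesgue[of "{1..}" "\<lambda>x. x powr (- (2 * r))"]
    by (simp add: mult.commute nn_integral_completion)
  have neg: "(\<integral>\<^sup>+x. ?t (- x) \<partial>lborel) = (\<integral>\<^sup>+x. ?t x \<partial>lborel)"
    using nn_integral_real_affine[of ?t "-1" 0] by simp
  have bound: "(1 + x\<^sup>2) powr (- r) \<le> x powr (- (2 * r))" if "1 \<le> x" for x :: real
  proof -
    have "(1 + x\<^sup>2) powr (- r) \<le> (x\<^sup>2) powr (- r)"
      using that r by (intro powr_mono2') auto
    also have "\<dots> = x powr (- (2 * r))"
      using that by (simp add: powr_powr flip: powr_numeral)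
    finally show ?thesis .
  qed
  have pt: "ennreal ((1 + x\<^sup>2) powr (- r)) \<le> indicator {-1..1} x + (?t x + ?t (- x))" for x :: real
  proof -
    consider "\<bar>x\<bar> \<le> 1" | "1 < x" | "x < -1" by linarith
    then show ?thesis
    proof cases
      case 1
      have "(1 + x\<^sup>2) powr (- r) \<le> 1 powr (- r)"
        using r by (intro powr_mono2') auto
      with 1 have "ennreal ((1 + x\<^sup>2) powr (- r)) \<le> indicator {-1..1} x"
        by (auto simp: indicator_def)
      then show ?thesis by (intro add_increasing2) auto
    next
      case 2
      with bound[of x] show ?thesis by (auto simp: indicator_def intro!: ennreal_leI)
    next
      case 3
      with bound[of "- x"] show ?thesis by (auto simp: indicator_def intro!: ennreal_leI)
    qed
  qed
  have "(\<integral>\<^sup>+x. ennreal ((1 + x\<^sup>2) powr (- r)) \<partial>(lborel :: real measure))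
      \<le> (\<integral>\<^sup>+x. indicator {-1..1} x + (?t x + ?t (- x)) \<partial>lborel)"
    by (intro nn_integral_mono pt)
  also have "\<dots> = 2 + ((\<integral>\<^sup>+x. ?t x \<partial>lborel) + (\<integral>\<^sup>+x. ?t (- x) \<partial>lborel))"
    by (simp add: nn_integral_add)
  also have "\<dots> < \<infinity>"
    using tail unfolding neg by (simp add: ennreal_add_eq_top less_top)
  finally show ?thesis .
qed

lemma integrable_inverse_one_plus_square: "integrable lborel (\<lambda>x::real. 1 / (1 + x\<^sup>2))"
proof (rule integrableI_bounded)
  have eq: "norm (1 / (1 + x\<^sup>2)) = (1 + x\<^sup>2) powr (- 1)" for x :: real
    by (simp add: powr_minus_divide add_pos_nonneg)
  show "(\<integral>\<^sup>+x. ennreal (norm (1 / (1 + x\<^sup>2))) \<partial>(lborel :: real measure)) < \<infinity>"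
    unfolding eq using nn_integral_bracket_powr_finite[of 1] by simp
qed simp

text \<open>
  The removable singularity at 0 is filled, so that the lower bound on \<open>[-1, 1]\<close> below holds at every
  point.
\<close>

definition fejer :: "real \<Rightarrow> real" where
  "fejer t = (if t = 0 then 1 else (sin t / t)\<^sup>2)"

definition fejer_mass :: real where
  "fejer_mass = (LINT t|lborel. fejer t)"

lemma fejer_measurable [measurable]: "fejer \<in> borel_measurable borel"
  unfolding fejer_def[abs_def] by measurable

lemma fejer_nonneg: "0 \<le> fejer t"
  by (simp add: fejer_def)

lemma fejer_le_1: "fejer t \<le> 1"
  using abs_sin_x_le_abs_x[of t]
  by (auto simp: fejer_def power_divide divide_le_eq abs_le_square_iff)

lemma fejer_minus [simp]: "fejer (- t) = fejer t"
  by (simp add: fejer_def)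

lemma fejer_le: "fejer t \<le> 2 / (1 + t\<^sup>2)"
proof (cases "\<bar>t\<bar> \<le> 1")
  case True
  then have "t\<^sup>2 \<le> 1" by (simp add: abs_square_le_1)
  then have "1 \<le> 2 / (1 + t\<^sup>2)" by (simp add: le_divide_eq add_pos_nonneg)
  with fejer_le_1[of t] show ?thesis by simp
next
  case False
  then have t: "1 \<le> t\<^sup>2" "t \<noteq> 0" using abs_square_less_1[of t] by auto
  have "fejer t \<le> 1 / t\<^sup>2"
    using t by (simp add: fejer_def power_divide divide_right_mono abs_square_le_1)
  also have "\<dots> \<le> 2 / (1 + t\<^sup>2)"
    using t by (simp add: field_simps add_pos_nonneg)
  finally show ?thesis .
qed

lemma fejer_ge: "1 / 4 \<le> fejer t" if "\<bar>t\<bar> \<le> 1"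
proof (cases "t = 0")
  case False
  have "\<bar>sin t - t\<bar> \<le> \<bar>t\<bar> ^ 3 / 6"
    using Maclaurin_sin_bound[of t 3] by (simp add: eval_nat_numeral sin_coeff_def fact_numeral)
  also have "\<dots> \<le> \<bar>t\<bar> / 6"
    using that power_decreasing[of 1 3 "\<bar>t\<bar>"] by simp
  finally have "\<bar>t\<bar> / 2 \<le> \<bar>sin t\<bar>" by linarith
  then have "(\<bar>t\<bar> / 2)\<^sup>2 \<le> \<bar>sin t\<bar>\<^sup>2" by (intro power_mono) auto
  with False show ?thesis by (simp add: fejer_def power_divide field_simps)
qed (simp add: fejer_def)

lemma fejer_integrable: "integrable lborel fejer"
proof (rule Bochner_Integration.integrable_bound)
  show "integrable lborel (\<lambda>x::real. 2 * (1 / (1 + x\<^sup>2)))"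
    by (intro integrable_mult_right integrable_inverse_one_plus_square)
qed (use fejer_le fejer_nonneg in \<open>auto intro!: AE_I2 simp: abs_of_nonneg add_nonneg_nonneg\<close>)

lemma fejer_mass_pos: "0 < fejer_mass"
proof -
  have "(LINT t|lborel. indicator {-1..1::real} t *\<^sub>R (1/4 :: real)) \<le> (LINT t|lborel. fejer t)"
  proof (rule Bochner_Integration.integral_mono_AE)
    show "integrable lborel (\<lambda>t. indicator {-1..1::real} t *\<^sub>R (1/4 :: real))"
      by (intro integrable_scaleR_left integrable_real_indicator) auto
    show "AE t in lborel. indicator {-1..1::real} t *\<^sub>R (1/4 :: real) \<le> fejer t"
      using fejer_ge fejer_nonneg by (intro AE_I2) (auto simp: indicator_def abs_le_iff)
  qed (rule fejer_integrable)
  then have "(LINT t|lborel. indicator {-1..1::real} t *\<^sub>R (1/4 :: real)) \<le> fejer_mass"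
    unfolding fejer_mass_def .
  then show ?thesis by simp
qed

lemma one_minus_cos_eq: "1 - cos t = 2 * (sin (t / 2))\<^sup>2" for t :: real
  using cos_double_sin[of "t / 2"] by simp

text \<open>
  The substitution \<open>t \<mapsto> b * t\<close> gives the dependence on \<open>b\<close>.
\<close>

lemma has_bochner_integral_one_minus_cos:
  "\<exists>m :: real. \<forall>b. has_bochner_integral lborel (\<lambda>t. (1 - cos (b * t)) / t\<^sup>2) (\<bar>b\<bar> * m)"
proof (intro exI allI)
  let ?g = "\<lambda>t::real. (1 - cos t) / t\<^sup>2"
  have int: "integrable lborel ?g"
  proof (rule Bochner_Integration.integrable_bound)
    show "integrable lborel (\<lambda>t::real. (1/2) * fejer (0 + (1/2) * t))"
      by (intro integrable_mult_right lborel_integrable_real_affine fejer_integrable) simp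
    show "AE t in lborel. norm (?g t) \<le> norm ((1/2) * fejer (0 + (1/2) * t))"
      by (intro AE_I2) (simp add: fejer_def one_minus_cos_eq power_divide mult.commute)
  qed simp
  fix b :: real
  show "has_bochner_integral lborel (\<lambda>t. (1 - cos (b * t)) / t\<^sup>2) (\<bar>b\<bar> * integral\<^sup>L lborel ?g)"
  proof (cases "b = 0")
    case False
    have "has_bochner_integral lborel (\<lambda>t. ?g (0 + b * t)) (integral\<^sup>L lborel ?g /\<^sub>R \<bar>b\<bar>)"
      using int by (subst lborel_has_bochner_integral_real_affine_iff[symmetric, OF False])
        (rule has_bochner_integral_integrable)
    from has_bochner_integral_mult_right[OF this, of "b\<^sup>2"]
    have "has_bochner_integral lborel (\<lambda>t. b\<^sup>2 * ?g (0 + b * t))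
        (b\<^sup>2 * (integral\<^sup>L lborel ?g /\<^sub>R \<bar>b\<bar>))" by simp
    moreover have "b\<^sup>2 * ?g (0 + b * t) = (1 - cos (b * t)) / t\<^sup>2" for t
      using False by (simp add: power_mult_distrib)
    moreover have "b\<^sup>2 * (x /\<^sub>R \<bar>b\<bar>) = \<bar>b\<bar> * x" for x :: real
      using False by (cases "b < 0") (simp_all add: field_simps power2_eq_square)
    ultimately show ?thesis by (simp only:)
  qed (simp add: has_bochner_integral_zero)
qed

text \<open>
  The product \<open>sin\<^sup>2 t * cos (y * t)\<close> is a combination of cosines with frequencies \<open>y\<close>, \<open>y + 2\<close> and
  \<open>y - 2\<close>, so the transform of the kernel is a second difference of the absolute value. Being a
  second difference of a piecewise linear function, it is supported in \<open>[-2, 2]\<close>.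
\<close>

lemma has_bochner_integral_fejer_cos:
  "\<exists>m :: real. \<forall>y. has_bochner_integral lborel (\<lambda>t. fejer t * cos (y * t))
      (m * (\<bar>y + 2\<bar> + \<bar>y - 2\<bar> - 2 * \<bar>y\<bar>))"
proof -
  obtain m :: real where m:
    "\<And>b. has_bochner_integral lborel (\<lambda>t. (1 - cos (b * t)) / t\<^sup>2) (\<bar>b\<bar> * m)"
    using has_bochner_integral_one_minus_cos by blast
  show ?thesis
  proof (intro exI allI)
    fix y :: real
    let ?h = "\<lambda>b t. (1 - cos (b * t)) / t\<^sup>2 :: real"
    let ?f = "\<lambda>t. (1/4) * (?h (y + 2) t + ?h (y - 2) t - 2 * ?h y t)"
    have eq: "?f t = fejer t * cos (y * t)" if "t \<noteq> 0" for t
    proof -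
      have "cos ((y + 2) * t) + cos ((y - 2) * t) = 2 * cos (y * t) * cos (2 * t)"
        by (simp add: algebra_simps cos_add cos_diff)
      moreover have "cos (2 * t) = 1 - 2 * (sin t)\<^sup>2"
        by (rule cos_double_sin)
      ultimately have "2 * cos (y * t) - (cos ((y + 2) * t) + cos ((y - 2) * t))
          = 4 * (cos (y * t) * (sin t)\<^sup>2)"
        by (simp only:) (simp add: algebra_simps)
      moreover have "?f t = (1/4) * ((2 * cos (y * t) - (cos ((y + 2) * t) + cos ((y - 2) * t))) / t\<^sup>2)"
        by (simp add: add_divide_distrib diff_divide_distrib)
      ultimately show ?thesis using that by (simp add: fejer_def power_divide)
    qed
    have "has_bochner_integral lborel ?f
        ((1/4) * (\<bar>y + 2\<bar> * m + \<bar>y - 2\<bar> * m - 2 * (\<bar>y\<bar> * m)))"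
      by (intro has_bochner_integral_mult_right has_bochner_integral_diff has_bochner_integral_add m)
    then have "has_bochner_integral lborel (\<lambda>t. fejer t * cos (y * t))
        ((1/4) * (\<bar>y + 2\<bar> * m + \<bar>y - 2\<bar> * m - 2 * (\<bar>y\<bar> * m)))"
    proof (rule has_bochner_integralI_AE)
      have "AE t in lborel. t \<noteq> (0 :: real)" by (rule AE_lborel_singleton)
      then show "AE t in lborel. ?f t = fejer t * cos (y * t)"
        by (rule AE_mp) (intro AE_I2 impI eq)
    qed simp
    then show "has_bochner_integral lborel (\<lambda>t. fejer t * cos (y * t))
        (m / 4 * (\<bar>y + 2\<bar> + \<bar>y - 2\<bar> - 2 * \<bar>y\<bar>))"
      by (simp add: algebra_simps)
  qed
qed

lemma has_bochner_integral_fejer_sin: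
  "has_bochner_integral lborel (\<lambda>t. fejer t * sin (y * t)) 0"
proof -
  let ?f = "\<lambda>t. fejer t * sin (y * t)"
  have int: "integrable lborel ?f"
    by (rule Bochner_Integration.integrable_bound[OF fejer_integrable])
      (auto simp: abs_mult fejer_nonneg mult_left_le)
  have "integral\<^sup>L lborel ?f = (LINT t|lborel. ?f (0 + (-1) * t))"
    using lborel_integral_real_affine[of "-1" ?f 0] by simp
  also have "\<dots> = - integral\<^sup>L lborel ?f" by simp
  finally have "integral\<^sup>L lborel ?f = 0" by simp
  with int show ?thesis by (metis has_bochner_integral_integrable)
qed

lemma has_bochner_integral_fejer_cis:
  assumes "2 \<le> \<bar>y\<bar>"
  shows "has_bochner_integral lborel (\<lambda>t. complex_of_real (fejer t) * cis (y * t)) 0"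
proof -
  obtain m :: real where m: "\<And>y. has_bochner_integral lborel (\<lambda>t. fejer t * cos (y * t))
      (m * (\<bar>y + 2\<bar> + \<bar>y - 2\<bar> - 2 * \<bar>y\<bar>))"
    using has_bochner_integral_fejer_cos by blast
  have "\<bar>y + 2\<bar> + \<bar>y - 2\<bar> - 2 * \<bar>y\<bar> = 0" using assms by linarith
  then have c: "has_bochner_integral lborel (\<lambda>t. fejer t * cos (y * t)) 0"
    using m[of y] by simp
  have "has_bochner_integral lborel
      (\<lambda>t. complex_of_real (fejer t * cos (y * t)) + \<i> * complex_of_real (fejer t * sin (y * t)))
      (complex_of_real 0 + \<i> * complex_of_real 0)"
    by (intro has_bochner_integral_add has_bochner_integral_mult_right has_bochner_integral_of_real
        c has_bochner_integral_fejer_sin)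
  moreover have "complex_of_real (fejer t * cos (y * t)) + \<i> * complex_of_real (fejer t * sin (y * t))
      = complex_of_real (fejer t) * cis (y * t)" for t
    by (simp add: complex_eq_iff)
  ultimately show ?thesis by simp
qed

section \<open>Exponential sums with separated frequencies\<close>

lemma has_bochner_integral_lborel_prod:
  fixes f :: "'a::euclidean_space \<Rightarrow> real \<Rightarrow> complex"
  assumes f: "\<And>b. b \<in> Basis \<Longrightarrow> integrable lborel (f b)"
  shows "has_bochner_integral lborel (\<lambda>x::'a. \<Prod>b\<in>Basis. f b (x \<bullet> b))
    (\<Prod>b\<in>Basis. integral\<^sup>L lborel (f b))"
proof -
  have P: "product_sigma_finite (\<lambda>_::'a. lborel :: real measure)" ..
  note [measurable] = borel_measurable_integrable[OF f]
  let ?T = "\<lambda>g. \<Sum>b\<in>Basis. g b *\<^sub>R (b :: 'a)"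
  have T: "(\<Prod>b\<in>Basis. f b (?T g \<bullet> b)) = (\<Prod>b\<in>Basis. f b (g b))" for g
    by (intro prod.cong) auto
  have "has_bochner_integral (\<Pi>\<^sub>M b\<in>(Basis :: 'a set). lborel) (\<lambda>g. \<Prod>b\<in>Basis. f b (?T g \<bullet> b))
      (\<Prod>b\<in>Basis. integral\<^sup>L lborel (f b))"
    unfolding T has_bochner_integral_iff
    by (intro conjI 
      product_sigma_finite.product_integrable_prod[OF P]
      product_sigma_finite.product_integral_prod[OF P] f) auto
  then show ?thesis
    unfolding has_bochner_integral_iff
    by (subst (1 2) lborel_eq) (auto simp: integrable_distr_eq integral_distr)
qed

definition fejer_box :: "'a::euclidean_space \<Rightarrow> real" where
  "fejer_box x = (\<Prod>b\<in>Basis. fejer (x \<bullet> b))"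

lemma fejer_box_measurable [measurable]: "fejer_box \<in> borel_measurable borel"
  unfolding fejer_box_def[abs_def] by measurable

lemma fejer_box_nonneg: "0 \<le> fejer_box x"
  unfolding fejer_box_def by (intro prod_nonneg fejer_nonneg)

definition expsum :: "'a::euclidean_space set \<Rightarrow> ('a \<Rightarrow> complex) \<Rightarrow> 'a \<Rightarrow> complex" where
  "expsum X c w = (\<Sum>x\<in>X. c x * cis (- (x \<bullet> w)))"

lemma expsum_measurable [measurable]: "expsum X c \<in> borel_measurable borel"
  unfolding expsum_def[abs_def] cis_conv_exp by measurable

text \<open>
  A translation in the frequency variable multiplies the coefficients by phases and leaves their
  absolute values unchanged. Bounds in terms of \<open>\<Sum>\<bar>c x\<bar>\<^sup>2\<close> are hence automatically uniform under
  translations.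
\<close>

lemma expsum_shift: "expsum X c (w + b) = expsum X (\<lambda>x. c x * cis (- (x \<bullet> b))) w"
  unfolding expsum_def by (intro sum.cong) (auto simp: inner_add_right cis_mult algebra_simps)

text \<open>
  The threshold 2 is the radius of the support of the Fourier transform of the Fejer kernel. One
  coordinate suffices because the transform of a tensor product is a product.
\<close>

definition box_separated :: "'a::euclidean_space set \<Rightarrow> bool" where
  "box_separated X \<longleftrightarrow> (\<forall>x\<in>X. \<forall>y\<in>X. x \<noteq> y \<longrightarrow> (\<exists>b\<in>Basis. 2 \<le> \<bar>(x - y) \<bullet> b\<bar>))"

lemma has_bochner_integral_fejer_box_cis:
  fixes y :: "'a::euclidean_space"
  assumes y: "y \<noteq> 0 \<Longrightarrow> \<exists>b\<in>Basis. 2 \<le> \<bar>y \<bullet> b\<bar>"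
  shows "has_bochner_integral lborel (\<lambda>w. complex_of_real (fejer_box w) * cis (y \<bullet> w))
    (if y = 0 then of_real (fejer_mass ^ DIM('a)) else 0)"
proof -
  let ?f = "\<lambda>b t. complex_of_real (fejer t) * cis ((y \<bullet> b) * t)"
  have cis_prod: "cis (y \<bullet> w) = (\<Prod>b\<in>Basis. cis ((y \<bullet> b) * (w \<bullet> b)))" for w
    by (subst euclidean_inner) (simp add: cis_conv_exp exp_sum sum_distrib_left)
  have eq: "complex_of_real (fejer_box w) * cis (y \<bullet> w) = (\<Prod>b\<in>Basis. ?f b (w \<bullet> b))" for w
    by (simp add: fejer_box_def cis_prod prod.distrib)
  have int: "integrable lborel (?f b)" for b
  proof (rule Bochner_Integration.integrable_bound[OF fejer_integrable])
    show "?f b \<in> borel_measurable lborel" unfolding cis_conv_exp by measurable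
  qed (auto simp: norm_mult)
  have "has_bochner_integral lborel (\<lambda>w. complex_of_real (fejer_box w) * cis (y \<bullet> w))
      (\<Prod>b\<in>Basis. integral\<^sup>L lborel (?f b))"
    unfolding eq by (rule has_bochner_integral_lborel_prod) (rule int)
  moreover have "(\<Prod>b\<in>Basis. integral\<^sup>L lborel (?f b))
      = (if y = 0 then of_real (fejer_mass ^ DIM('a)) else 0)"
  proof (cases "y = 0")
    case True
    then show ?thesis by (simp add: fejer_mass_def)
  next
    case False
    then obtain b :: 'a where b: "b \<in> Basis" "2 \<le> \<bar>y \<bullet> b\<bar>" using y by blast
    then have "integral\<^sup>L lborel (?f b) = 0"
      using has_bochner_integral_fejer_cis by (simp add: has_bochner_integral_iff)
    with b(1) False show ?thesis by (auto simp: prod_zero_iff)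
  qed
  ultimately show ?thesis by simp
qed

text \<open>
  After expanding the square, all off-diagonal terms integrate to zero.
\<close>

lemma nn_integral_fejer_box_expsum:
  fixes X :: "'a::euclidean_space set"
  assumes X: "finite X" "box_separated X"
  shows "(\<integral>\<^sup>+w. ennreal (fejer_box w * (cmod (expsum X c w))\<^sup>2) \<partial>lborel)
    = ennreal (fejer_mass ^ DIM('a) * (\<Sum>x\<in>X. (cmod (c x))\<^sup>2))"
proof -
  let ?k = "\<lambda>x y. if y - x = 0 then of_real (fejer_mass ^ DIM('a)) else 0 :: complex"
  let ?g = "\<lambda>w. \<Sum>x\<in>X. \<Sum>y\<in>X. c x * cnj (c y) * (complex_of_real (fejer_box w) * cis ((y - x) \<bullet> w))"
  have sq: "complex_of_real (fejer_box w * (cmod (expsum X c w))\<^sup>2) = ?g w" for w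
  proof -
    have "complex_of_real ((cmod (expsum X c w))\<^sup>2) = expsum X c w * cnj (expsum X c w)"
      by (rule complex_norm_square)
    also have "\<dots> = (\<Sum>x\<in>X. \<Sum>y\<in>X. c x * cnj (c y) * cis ((y - x) \<bullet> w))"
      unfolding expsum_def cnj_sum sum_product
      by (intro sum.cong refl)
        (simp add: cis_cnj cis_mult inner_diff_left mult.assoc mult.left_commute[of "cis _"])
    finally show ?thesis by (simp add: sum_distrib_left mult_ac)
  qed
  have "has_bochner_integral lborel ?g (\<Sum>x\<in>X. \<Sum>y\<in>X. c x * cnj (c y) * ?k x y)"
    using X(2) by (intro has_bochner_integral_sum has_bochner_integral_mult_right
        has_bochner_integral_fejer_box_cis) (auto simp: box_separated_def)
  also have "(\<Sum>x\<in>X. \<Sum>y\<in>X. c x * cnj (c y) * ?k x y)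
      = (\<Sum>x\<in>X. \<Sum>y\<in>X. if x = y then c x * cnj (c x) * of_real (fejer_mass ^ DIM('a)) else 0)"
    by (intro sum.cong) auto
  also have "\<dots> = complex_of_real (fejer_mass ^ DIM('a) * (\<Sum>x\<in>X. (cmod (c x))\<^sup>2))"
    using X(1) by (simp add: complex_norm_square sum_distrib_left mult_ac del: of_real_power)
  finally have "has_bochner_integral lborel (\<lambda>w. complex_of_real (fejer_box w * (cmod (expsum X c w))\<^sup>2))
      (complex_of_real (fejer_mass ^ DIM('a) * (\<Sum>x\<in>X. (cmod (c x))\<^sup>2)))"
    unfolding sq .
  then have "has_bochner_integral lborel (\<lambda>w. fejer_box w * (cmod (expsum X c w))\<^sup>2)
      (fejer_mass ^ DIM('a) * (\<Sum>x\<in>X. (cmod (c x))\<^sup>2))"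
    using has_bochner_integral_Re by fastforce
  then show ?thesis
    by (simp add: has_bochner_integral_iff nn_integral_eq_integral fejer_box_nonneg)
qed

lemma nn_integral_lborel_shift:
  fixes f :: "'a::euclidean_space \<Rightarrow> ennreal"
  assumes [measurable]: "f \<in> borel_measurable borel"
  shows "(\<integral>\<^sup>+x. f (x + b) \<partial>lborel) = (\<integral>\<^sup>+x. f x \<partial>lborel)"
proof -
  have "(\<integral>\<^sup>+x. f x \<partial>lborel) = (\<integral>\<^sup>+x. f x \<partial>distr lborel borel ((+) b))"
    by (simp add: lborel_distr_plus)
  also have "\<dots> = (\<integral>\<^sup>+x. f (x + b) \<partial>lborel)"
    by (simp add: nn_integral_distr add.commute)
  finally show ?thesis by simp
qed

lemma nn_integral_fejer_box_shift_expsum: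
  fixes X :: "'a::euclidean_space set"
  assumes X: "finite X" "box_separated X"
  shows "(\<integral>\<^sup>+w. ennreal (fejer_box (w - b) * (cmod (expsum X c w))\<^sup>2) \<partial>lborel)
    = ennreal (fejer_mass ^ DIM('a) * (\<Sum>x\<in>X. (cmod (c x))\<^sup>2))"
proof -
  have "(\<integral>\<^sup>+w. ennreal (fejer_box (w - b) * (cmod (expsum X c w))\<^sup>2) \<partial>lborel)
      = (\<integral>\<^sup>+w. ennreal (fejer_box (w + b - b) * (cmod (expsum X c (w + b)))\<^sup>2) \<partial>lborel)"
    by (rule nn_integral_lborel_shift[symmetric]) measurable
  then show ?thesis
    by (simp add: expsum_shift nn_integral_fejer_box_expsum[OF X] norm_mult)
qed

text \<open>
  The kernel is at least \<open>(1/4) ^ d\<close> on the cube of half-width 1 around its centre. Hence \<open>U\<close> is dominated by a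
  superposition of translated kernels with density \<open>W\<close>, and by Tonelli's theorem each of them
  contributes the same multiple of \<open>\<Sum>\<bar>c x\<bar>\<^sup>2\<close>. Two weights are used instead of one in order
  to cover discontinuous \<open>U\<close>, such as a weight cut off to the complement of a ball.
\<close>

lemma nn_integral_weight_expsum_le:
  fixes X :: "'a::euclidean_space set" and U W :: "'a \<Rightarrow> ennreal"
  assumes X: "finite X" "box_separated X"
    and [measurable]: "U \<in> borel_measurable borel" "W \<in> borel_measurable borel"
    and UW: "\<And>w b. (\<And>i. i \<in> Basis \<Longrightarrow> \<bar>(w - b) \<bullet> i\<bar> \<le> 1) \<Longrightarrow> U w \<le> W b"
  shows "(\<integral>\<^sup>+w. U w * ennreal ((cmod (expsum X c w))\<^sup>2) \<partial>lborel)
    \<le> ennreal ((2 * fejer_mass) ^ DIM('a) * (\<Sum>x\<in>X. (cmod (c x))\<^sup>2)) * (\<integral>\<^sup>+b. W b \<partial>lborel)"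
proof -
  let ?d = "DIM('a)" and ?P = "\<lambda>w. (cmod (expsum X c w))\<^sup>2"
  let ?I = "\<lambda>w::'a. cbox (w - One) (w + One)"
  have in_I: "\<bar>(w - b) \<bullet> i\<bar> \<le> 1" if "b \<in> ?I w" "i \<in> Basis" for w b i
    using that by (auto simp: mem_box inner_diff_left inner_add_left abs_le_iff algebra_simps)
  have pt: "U w \<le> ennreal (2 ^ ?d) * (\<integral>\<^sup>+b. W b * ennreal (fejer_box (w - b)) \<partial>lborel)" for w
  proof -
    have vol: "emeasure lborel (?I w) = ennreal (2 ^ ?d)"
      by (subst emeasure_lborel_cbox) (auto simp: inner_diff_left inner_add_left)
    \<comment> \<open>The cube has volume \<open>2 ^ d\<close> and the kernel costs \<open>4 ^ d\<close>, which leaves the factor \<open>2 ^ d\<close>.\<close>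
    have "U w = ennreal (2 ^ ?d) * (ennreal ((1/4) ^ ?d) * (U w * ennreal (2 ^ ?d)))"
    proof -
      have "ennreal (2 ^ ?d) * ennreal ((1/4) ^ ?d) * ennreal (2 ^ ?d) = 1"
        by (simp flip: ennreal_mult power_mult_distrib)
      then have "U w = (ennreal (2 ^ ?d) * ennreal ((1/4) ^ ?d) * ennreal (2 ^ ?d)) * U w"
        by simp
      then show ?thesis by (simp only: mult_ac)
    qed
    also have "ennreal ((1/4) ^ ?d) * (U w * ennreal (2 ^ ?d))
        = (\<integral>\<^sup>+b. ennreal ((1/4) ^ ?d) * U w * indicator (?I w) b \<partial>lborel)"
      by (subst nn_integral_cmult) (auto simp: vol mult.assoc)
    also have "\<dots> \<le> (\<integral>\<^sup>+b. W b * ennreal (fejer_box (w - b)) \<partial>lborel)"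
    proof (rule nn_integral_mono)
      fix b :: 'a
      show "ennreal ((1/4) ^ ?d) * U w * indicator (?I w) b \<le> W b * ennreal (fejer_box (w - b))"
      proof (cases "b \<in> ?I w")
        case True
        have "(\<Prod>i\<in>(Basis :: 'a set). 1/4) \<le> fejer_box (w - b)"
          unfolding fejer_box_def by (intro prod_mono conjI fejer_ge in_I[OF True]) auto
        then have "ennreal ((1/4) ^ ?d) \<le> ennreal (fejer_box (w - b))"
          by (intro ennreal_leI) simp
        moreover have "U w \<le> W b" by (rule UW) (rule in_I[OF True])
        ultimately show ?thesis using True by (simp add: mult_mono mult.commute)
      qed simp
    qed
    finally show ?thesis by (simp add: mult_left_mono)
  qed
  have "(\<integral>\<^sup>+w. U w * ennreal (?P w) \<partial>lborel)
      \<le> (\<integral>\<^sup>+w. (ennreal (2 ^ ?d) * (\<integral>\<^sup>+b. W b * ennreal (fejer_box (w - b)) \<partial>lborel)) * ennreal (?P w) \<partial>lborel)"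
    by (intro nn_integral_mono mult_right_mono pt) auto
  also have "\<dots> = ennreal (2 ^ ?d) *
      (\<integral>\<^sup>+w. \<integral>\<^sup>+b. W b * ennreal (fejer_box (w - b) * ?P w) \<partial>lborel \<partial>lborel)"
    by (subst nn_integral_cmult[symmetric])
      (auto simp: nn_integral_multc[symmetric] nn_integral_cmult[symmetric] ennreal_mult fejer_box_nonneg mult_ac intro!: nn_integral_cong)
  also have "(\<integral>\<^sup>+w. \<integral>\<^sup>+b. W b * ennreal (fejer_box (w - b) * ?P w) \<partial>lborel \<partial>lborel)
      = (\<integral>\<^sup>+b. \<integral>\<^sup>+w. W b * ennreal (fejer_box (w - b) * ?P w) \<partial>lborel \<partial>lborel)"
    by (rule lborel_pair.Fubini'[symmetric]) measurable
  also have "\<dots> = (\<integral>\<^sup>+b. W b * ennreal (fejer_mass ^ ?d * (\<Sum>x\<in>X. (cmod (c x))\<^sup>2)) \<partial>lborel)"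
    by (subst nn_integral_cmult) (auto simp: nn_integral_fejer_box_shift_expsum[OF X])
  also have "\<dots> = (\<integral>\<^sup>+b. W b \<partial>lborel) * ennreal (fejer_mass ^ ?d * (\<Sum>x\<in>X. (cmod (c x))\<^sup>2))"
    by (rule nn_integral_multc) measurable
  finally show ?thesis
    using fejer_mass_pos
    by (simp add: ennreal_mult sum_nonneg power_mult_distrib mult_ac)
qed

section \<open>Upper and lower bounds for weighted square integrals\<close>

text \<open>
  A product weight reduces integrability in dimension \<open>d\<close> to dimension one. It dominates the isotropic
  weight \<open>(1 + \<bar>x\<bar>\<^sup>2) powr (- p)\<close> with \<open>r = p / d\<close>, so that \<open>p > d / 2\<close> corresponds exactly to the
  one-dimensional condition \<open>r > 1 / 2\<close>.
\<close>

definition tensor_weight :: "real \<Rightarrow> 'a::euclidean_space \<Rightarrow> real" where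
  "tensor_weight r x = (\<Prod>b\<in>Basis. (1 + (x \<bullet> b)\<^sup>2) powr (- r))"

lemma tensor_weight_measurable [measurable]: "tensor_weight r \<in> borel_measurable borel"
  unfolding tensor_weight_def[abs_def] by measurable

lemma tensor_weight_nonneg: "0 \<le> tensor_weight r x"
  unfolding tensor_weight_def by (intro prod_nonneg) simp

lemma nn_integral_tensor_weight_finite:
  assumes "1 / 2 < r"
  shows "(\<integral>\<^sup>+x. ennreal (tensor_weight r (x :: 'a::euclidean_space)) \<partial>lborel) < \<infinity>"
proof -
  have "(\<integral>\<^sup>+(x::'a). ennreal (tensor_weight r x) \<partial>lborel)
      = (\<integral>\<^sup>+(x::'a). (\<Prod>b\<in>Basis. ennreal ((1 + (x \<bullet> b)\<^sup>2) powr (- r))) \<partial>lborel)"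
    unfolding tensor_weight_def by (simp add: prod_ennreal)
  also have "\<dots> = (\<Prod>b\<in>(Basis :: 'a set). \<integral>\<^sup>+x. ennreal ((1 + x\<^sup>2) powr (- r)) \<partial>lborel)"
    by (rule nn_integral_lborel_prod) auto
  also have "\<dots> < \<infinity>"
    using nn_integral_bracket_powr_finite[OF assms]
    by (simp add: less_top[symmetric] ennreal_prod_eq_top power_eq_top_ennreal)
  finally show ?thesis .
qed

lemma tensor_weight_slowly_varying:
  assumes wb: "\<And>i. i \<in> Basis \<Longrightarrow> \<bar>(w - b) \<bullet> i\<bar> \<le> 1" and r: "0 \<le> r"
  shows "tensor_weight r w \<le> (4 powr r) ^ DIM('a) * tensor_weight r (b :: 'a::euclidean_space)"
proof -
  have "tensor_weight r w \<le> (\<Prod>i\<in>(Basis :: 'a set). 4 powr r * (1 + (b \<bullet> i)\<^sup>2) powr (- r))"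
    unfolding tensor_weight_def
  proof (intro prod_mono conjI)
    fix i :: 'a assume i: "i \<in> Basis"
    have "(w \<bullet> i - b \<bullet> i)\<^sup>2 \<le> 1" using wb[OF i] by (simp add: inner_diff_left abs_square_le_1)
    moreover have "0 \<le> (2 * (w \<bullet> i) - b \<bullet> i)\<^sup>2" by simp
    \<comment> \<open>with \<open>e = w - b\<close> in this coordinate, \<open>b\<^sup>2 = 2 w\<^sup>2 + 2 e\<^sup>2 - (2 w - b)\<^sup>2\<close>\<close>
    ultimately have "(b \<bullet> i)\<^sup>2 \<le> 2 + 2 * (w \<bullet> i)\<^sup>2"
      by (simp add: power2_eq_square algebra_simps)
    also have "2 + 2 * (w \<bullet> i)\<^sup>2 \<le> 3 + 4 * (w \<bullet> i)\<^sup>2"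
      by (intro add_mono mult_right_mono) auto
    finally have "(1 + (b \<bullet> i)\<^sup>2) / 4 \<le> 1 + (w \<bullet> i)\<^sup>2" by simp
    then have "(1 + (w \<bullet> i)\<^sup>2) powr (- r) \<le> ((1 + (b \<bullet> i)\<^sup>2) / 4) powr (- r)"
      using r by (intro powr_mono2') (auto simp: add_pos_nonneg)
    also have "\<dots> = 4 powr r * (1 + (b \<bullet> i)\<^sup>2) powr (- r)"
      by (simp add: powr_divide add_nonneg_nonneg powr_minus_divide)
    finally show "(1 + (w \<bullet> i)\<^sup>2) powr (- r) \<le> 4 powr r * (1 + (b \<bullet> i)\<^sup>2) powr (- r)" .
  qed simp
  then show ?thesis by (simp add: prod.distrib tensor_weight_def)
qed

lemma bracket_powr_le_tensor_weight:
  fixes w :: "'a::euclidean_space"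
  assumes "0 \<le> p"
  shows "(1 + (norm w)\<^sup>2) powr (- p) \<le> tensor_weight (p / DIM('a)) w"
proof -
  have "1 + (norm w)\<^sup>2 \<noteq> 0" using zero_le_power2[of "norm w"] by linarith
  then have "(1 + (norm w)\<^sup>2) powr (- p) = (\<Prod>i\<in>(Basis :: 'a set). (1 + (norm w)\<^sup>2) powr (- (p / DIM('a))))"
    by (simp add: powr_realpow[symmetric] powr_powr)
  also have "\<dots> \<le> tensor_weight (p / DIM('a)) w"
    unfolding tensor_weight_def
  proof (intro prod_mono conjI)
    fix i :: 'a assume i: "i \<in> Basis"
    have "(w \<bullet> i)\<^sup>2 \<le> (norm w)\<^sup>2"
      using power_mono[OF Basis_le_norm[OF i, of w], of 2] by simp
    then show "(1 + (norm w)\<^sup>2) powr (- (p / DIM('a))) \<le> (1 + (w \<bullet> i)\<^sup>2) powr (- (p / DIM('a)))"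
      using assms by (intro powr_mono2') (auto simp: add_pos_nonneg)
  qed simp
  finally show ?thesis .
qed

text \<open>
  Integrable polynomial weights vary slowly at scale 1, so the upper bound applies to them with the
  same weight on both sides, up to a factor.
\<close>

lemma nn_integral_bracket_expsum_le:
  fixes p :: real
  assumes p: "DIM('a::euclidean_space) / 2 < p"
  shows "\<exists>D>0. \<forall>(X :: 'a set) c. finite X \<longrightarrow> box_separated X \<longrightarrow>
    (\<integral>\<^sup>+w. ennreal ((1 + (norm w)\<^sup>2) powr (- p) * (cmod (expsum X c w))\<^sup>2) \<partial>lborel)
      \<le> ennreal (D * (\<Sum>x\<in>X. (cmod (c x))\<^sup>2))"
proof -
  let ?d = "DIM('a)"
  define r where "r = p / ?d"
  have r: "1 / 2 < r" using p by (simp add: r_def field_simps)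
  let ?W = "\<lambda>b::'a. ennreal ((4 powr r) ^ ?d * tensor_weight r b)"
  have "(\<integral>\<^sup>+b. ?W b \<partial>lborel) = ennreal ((4 powr r) ^ ?d) * (\<integral>\<^sup>+b. ennreal (tensor_weight r (b::'a)) \<partial>lborel)"
    by (simp add: ennreal_mult tensor_weight_nonneg nn_integral_cmult)
  also have "\<dots> < \<infinity>"
    using nn_integral_tensor_weight_finite[OF r, where 'a='a] by (simp add: ennreal_mult_less_top)
  finally obtain I where I: "0 \<le> I" "(\<integral>\<^sup>+b. ?W b \<partial>lborel) = ennreal I"
    by (cases "\<integral>\<^sup>+b. ?W b \<partial>lborel" rule: ennreal_cases) auto
  \<comment> \<open>the summand 1 gives positivity without a discussion of \<open>I = 0\<close>\<close>
  define D where "D = (2 * fejer_mass) ^ ?d * I + 1"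
  have D: "0 < D" using I(1) fejer_mass_pos by (simp add: D_def add_nonneg_pos)
  have "(\<integral>\<^sup>+w. ennreal ((1 + (norm w)\<^sup>2) powr (- p) * (cmod (expsum X c w))\<^sup>2) \<partial>lborel)
      \<le> ennreal (D * (\<Sum>x\<in>X. (cmod (c x))\<^sup>2))"
    if X: "finite X" "box_separated X" for X :: "'a set" and c
  proof -
    let ?S = "\<Sum>x\<in>X. (cmod (c x))\<^sup>2"
    have "(\<integral>\<^sup>+w. ennreal ((1 + (norm w)\<^sup>2) powr (- p) * (cmod (expsum X c w))\<^sup>2) \<partial>lborel)
        = (\<integral>\<^sup>+w. ennreal ((1 + (norm w)\<^sup>2) powr (- p)) * ennreal ((cmod (expsum X c w))\<^sup>2) \<partial>lborel)"
      by (simp add: ennreal_mult)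
    also have "\<dots> \<le> ennreal ((2 * fejer_mass) ^ ?d * ?S) * (\<integral>\<^sup>+b. ?W b \<partial>lborel)"
    proof (rule nn_integral_weight_expsum_le[OF X])
      fix w b :: 'a assume wb: "\<And>i. i \<in> Basis \<Longrightarrow> \<bar>(w - b) \<bullet> i\<bar> \<le> 1"
      have "(1 + (norm w)\<^sup>2) powr (- p) \<le> tensor_weight r w"
        unfolding r_def by (intro bracket_powr_le_tensor_weight order_trans[OF _ less_imp_le[OF p]]) simp
      also have "\<dots> \<le> (4 powr r) ^ ?d * tensor_weight r b"
        using r by (intro tensor_weight_slowly_varying wb) auto
      finally show "ennreal ((1 + (norm w)\<^sup>2) powr (- p)) \<le> ?W b" by (rule ennreal_leI)
    qed measurable
    also have "\<dots> = ennreal ((2 * fejer_mass) ^ ?d * ?S * I)"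
      using I fejer_mass_pos by (simp add: ennreal_mult sum_nonneg)
    also have "\<dots> \<le> ennreal (D * ?S)"
      by (intro ennreal_leI) (simp add: D_def algebra_simps sum_nonneg)
    finally show ?thesis .
  qed
  with D show ?thesis by blast
qed

lemma fejer_box_le_1: "fejer_box x \<le> 1"
  unfolding fejer_box_def by (intro prod_le_1) (simp add: fejer_nonneg fejer_le_1)

lemma fejer_box_le_tensor_weight: "fejer_box x \<le> 2 ^ DIM('a) * tensor_weight 1 (x :: 'a::euclidean_space)"
proof -
  have "fejer_box x \<le> (\<Prod>i\<in>(Basis :: 'a set). 2 * (1 + (x \<bullet> i)\<^sup>2) powr (- 1))"
    unfolding fejer_box_def using fejer_le fejer_nonneg
    by (intro prod_mono) (auto simp: powr_minus_divide add_pos_nonneg)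
  then show ?thesis by (simp only: tensor_weight_def prod.distrib prod_constant)
qed

lemma nn_integral_tail_tendsto_0:
  fixes f :: "'a::euclidean_space \<Rightarrow> real"
  assumes [measurable]: "f \<in> borel_measurable borel" and fin: "(\<integral>\<^sup>+x. ennreal (f x) \<partial>lborel) < \<infinity>"
  shows "(\<lambda>n. \<integral>\<^sup>+x. ennreal (f x) * indicator {x. real n < norm x} x \<partial>lborel) \<longlonglongrightarrow> 0"
proof -
  have "(\<lambda>n. \<integral>\<^sup>+x. ennreal (f x) * indicator {x. real n < norm x} x \<partial>lborel)
      \<longlonglongrightarrow> (\<integral>\<^sup>+(x::'a). 0 \<partial>lborel)"
  proof (rule nn_integral_dominated_convergence[OF _ _ _ _ fin])
    show "AE x in lborel. (\<lambda>n. ennreal (f x) * indicator {x. real n < norm x} x) \<longlonglongrightarrow> 0"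
    proof (intro AE_I2)
      fix x :: 'a
      obtain N :: nat where "norm x < real N" using reals_Archimedean2 by blast
      then have "\<forall>\<^sub>F n in sequentially. ennreal (f x) * indicator {x. real n < norm x} x = 0"
        by (intro eventually_mono[OF eventually_ge_at_top[of N]]) auto
      then show "(\<lambda>n. ennreal (f x) * indicator {x. real n < norm x} x) \<longlonglongrightarrow> 0"
        by (rule tendsto_eventually)
    qed
  qed (auto simp: indicator_def)
  then show ?thesis by simp
qed

text \<open>
  The whole weighted integral equals \<open>fejer_mass ^ d * \<Sum>\<bar>c x\<bar>\<^sup>2\<close>. By the upper bound, applied to the
  kernel cut off to the complement of a ball, the part outside a large ball is at most half of
  this, and inside the ball the kernel is at most 1. The radius does not depend on the number of
  points. The case of a general centre follows by translation.
\<close>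

lemma expsum_ball_lower_bound:
  "\<exists>R>0. \<forall>(X :: 'a::euclidean_space set) c b. finite X \<longrightarrow> box_separated X \<longrightarrow>
    ennreal (fejer_mass ^ DIM('a) / 2 * (\<Sum>x\<in>X. (cmod (c x))\<^sup>2))
      \<le> (\<integral>\<^sup>+w. indicator (cball b R) w * ennreal ((cmod (expsum X c w))\<^sup>2) \<partial>lborel)"
proof -
  let ?d = "DIM('a)" and ?K = "fejer_mass ^ DIM('a)"
  let ?h = "\<lambda>b::'a. 2 ^ ?d * ((4 powr 1) ^ ?d * tensor_weight 1 b)"
  have "(\<integral>\<^sup>+b. ennreal (?h b) \<partial>lborel)
      = ennreal (2 ^ ?d * (4 powr 1) ^ ?d) * (\<integral>\<^sup>+b. ennreal (tensor_weight 1 (b::'a)) \<partial>lborel)"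
    by (subst nn_integral_cmult[symmetric]) (auto simp: ennreal_mult tensor_weight_nonneg mult_ac)
  also have "\<dots> < \<infinity>"
    using nn_integral_tensor_weight_finite[of 1, where 'a='a] by (simp add: ennreal_mult_less_top)
  finally have "(\<lambda>n. \<integral>\<^sup>+b. ennreal (?h b) * indicator {x. real n < norm x} b \<partial>lborel) \<longlonglongrightarrow> 0"
    by (intro nn_integral_tail_tendsto_0) auto
  \<comment> \<open>The upper bound has the constant \<open>(2 * fejer_mass) ^ d\<close>; a tail below \<open>1 / (2 * 2 ^ d)\<close> turns it
    into half of \<open>fejer_mass ^ d\<close>.\<close>
  then have "\<forall>\<^sub>F n in sequentially. (\<integral>\<^sup>+b. ennreal (?h b) * indicator {x. real n < norm x} b \<partial>lborel)
      < ennreal (1 / (2 * 2 ^ ?d))"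
    by (rule order_tendstoD) simp
  then obtain n where n: "(\<integral>\<^sup>+b. ennreal (?h b) * indicator {x. real n < norm x} b \<partial>lborel)
      < ennreal (1 / (2 * 2 ^ ?d))"
    by (auto simp: eventually_sequentially)
  \<comment> \<open>Passing from \<open>w\<close> to a point \<open>b\<close> at most 1 away in each coordinate changes the norm by at most \<open>d\<close>.\<close>
  define R where "R = real n + real ?d"
  have [measurable]: "cball b R \<in> sets borel" for b :: 'a by simp
  have R: "0 < R" by (simp add: R_def add_nonneg_pos)
  have centred: "ennreal (?K / 2 * (\<Sum>x\<in>X. (cmod (c x))\<^sup>2))
      \<le> (\<integral>\<^sup>+w. indicator (cball 0 R) w * ennreal ((cmod (expsum X c w))\<^sup>2) \<partial>lborel)" (is "_ \<le> ?A")
    if X: "finite X" "box_separated X" for X :: "'a set" and c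
  proof -
    let ?S = "\<Sum>x\<in>X. (cmod (c x))\<^sup>2" and ?P = "\<lambda>w. (cmod (expsum X c w))\<^sup>2"
    have S: "0 \<le> ?S" by (intro sum_nonneg) simp
    let ?U = "\<lambda>w::'a. ennreal (fejer_box w) * indicator {w. R < norm w} w"
    have "ennreal (?K * ?S) = (\<integral>\<^sup>+w. ennreal (fejer_box w * ?P w) \<partial>lborel)"
      by (rule nn_integral_fejer_box_expsum[OF X, symmetric])
    also have "\<dots> \<le> (\<integral>\<^sup>+w. indicator (cball 0 R) w * ennreal (?P w) + ?U w * ennreal (?P w) \<partial>lborel)"
    proof (rule nn_integral_mono)
      fix w :: 'a
      show "ennreal (fejer_box w * ?P w) \<le> indicator (cball 0 R) w * ennreal (?P w) + ?U w * ennreal (?P w)"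
        using fejer_box_le_1[of w] fejer_box_nonneg[of w]
        by (auto simp: indicator_def ennreal_mult intro!: ennreal_leI mult_left_le_one_le simp flip: ennreal_mult)
    qed
    also have "\<dots> = ?A + (\<integral>\<^sup>+w. ?U w * ennreal (?P w) \<partial>lborel)"
      by (rule nn_integral_add) measurable
    also have "(\<integral>\<^sup>+w. ?U w * ennreal (?P w) \<partial>lborel)
        \<le> ennreal ((2 * fejer_mass) ^ ?d * ?S) * (\<integral>\<^sup>+b. ennreal (?h b) * indicator {x. real n < norm x} b \<partial>lborel)"
    proof (rule nn_integral_weight_expsum_le[OF X])
      fix w b :: 'a assume wb: "\<And>i. i \<in> Basis \<Longrightarrow> \<bar>(w - b) \<bullet> i\<bar> \<le> 1"
      have "norm (w - b) \<le> (\<Sum>i\<in>Basis. \<bar>(w - b) \<bullet> i\<bar>)" by (rule norm_le_l1)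
      also have "\<dots> \<le> real ?d" using sum_mono[of Basis "\<lambda>i. \<bar>(w - b) \<bullet> i\<bar>" "\<lambda>_. 1"] wb by simp
      finally have far: "real n < norm b" if "R < norm w"
        using that norm_triangle_ineq2[of w b] by (simp add: R_def)
      have "fejer_box w \<le> 2 ^ ?d * tensor_weight 1 w" by (rule fejer_box_le_tensor_weight)
      also have "\<dots> \<le> ?h b"
        by (intro mult_left_mono tensor_weight_slowly_varying wb) auto
      finally show "?U w \<le> ennreal (?h b) * indicator {x. real n < norm x} b"
        using far by (auto simp: indicator_def intro!: ennreal_leI)
    qed measurable
    also have "\<dots> \<le> ennreal ((2 * fejer_mass) ^ ?d * ?S) * ennreal (1 / (2 * 2 ^ ?d))"
      using n by (intro mult_left_mono) auto
    also have "\<dots> = ennreal (?K / 2 * ?S)"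
      using S fejer_mass_pos by (simp add: power_mult_distrib flip: ennreal_mult)
    finally have le: "ennreal (?K * ?S) \<le> ?A + ennreal (?K / 2 * ?S)" by (simp add: add_left_mono)
    have KS: "0 \<le> ?K * ?S" using S fejer_mass_pos by simp
    show ?thesis
    proof (cases ?A rule: ennreal_cases)
      case (real a)
      with le KS have "?K * ?S \<le> a + ?K / 2 * ?S"
        by (simp add: ennreal_plus[symmetric] ennreal_le_iff del: ennreal_plus)
      then show ?thesis unfolding real(2) by (intro ennreal_leI) simp
    qed simp
  qed
  have "ennreal (?K / 2 * (\<Sum>x\<in>X. (cmod (c x))\<^sup>2))
      \<le> (\<integral>\<^sup>+w. indicator (cball b R) w * ennreal ((cmod (expsum X c w))\<^sup>2) \<partial>lborel)"
    if X: "finite X" "box_separated X" for X :: "'a set" and c b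
  proof -
    let ?c = "\<lambda>x. c x * cis (- (x \<bullet> b))"
    have "(\<integral>\<^sup>+w. indicator (cball b R) w * ennreal ((cmod (expsum X c w))\<^sup>2) \<partial>lborel)
        = (\<integral>\<^sup>+w. indicator (cball b R) (w + b) * ennreal ((cmod (expsum X c (w + b)))\<^sup>2) \<partial>lborel)"
      by (rule nn_integral_lborel_shift[symmetric]) measurable
    also have "\<dots> = (\<integral>\<^sup>+w. indicator (cball 0 R) w * ennreal ((cmod (expsum X ?c w))\<^sup>2) \<partial>lborel)"
      by (intro nn_integral_cong) (auto simp: indicator_def dist_norm expsum_shift)
    finally show ?thesis using centred[OF X, of ?c] by (simp add: norm_mult)
  qed
  with R show ?thesis by blast
qed

section \<open>Comparison of the Sobolev weights\<close>

lemma nn_integral_lborel_scale: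
  fixes f :: "'a::euclidean_space \<Rightarrow> ennreal"
  assumes [measurable]: "f \<in> borel_measurable borel" and c: "0 < c"
  shows "(\<integral>\<^sup>+x. f x \<partial>lborel) = ennreal (c ^ DIM('a)) * (\<integral>\<^sup>+x. f (c *\<^sub>R x) \<partial>lborel)"
  using c by (subst lborel_affine[of c 0]) (simp_all add: nn_integral_density nn_integral_distr nn_integral_cmult)

lemma rescaled_bracket_le_low:
  fixes w :: "'a::real_normed_vector"
  assumes a: "0 < a" "a \<le> a\<^sub>0" and \<alpha>\<tau>: "\<alpha> \<le> \<tau>" and w: "norm w \<le> 1"
  shows "(1 + (norm w)\<^sup>2 / a\<^sup>2) powr \<tau>
    \<le> (a\<^sub>0\<^sup>2 + 1) powr (\<tau> - \<alpha>) * (a\<^sup>2) powr (\<alpha> - \<tau>) * (1 + (norm w)\<^sup>2 / a\<^sup>2) powr \<alpha>"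
proof -
  let ?A = "a\<^sub>0\<^sup>2 + 1" and ?B = "1 + (norm w)\<^sup>2 / a\<^sup>2"
  have a2: "0 < a\<^sup>2" "a\<^sup>2 \<le> a\<^sub>0\<^sup>2" using a by (auto intro: power_mono)
  have A: "0 < ?A" by (simp add: add_nonneg_pos)
  have "(norm w)\<^sup>2 \<le> 1" using w by (simp add: abs_square_le_1)
  then have "(a\<^sup>2 + (norm w)\<^sup>2) / a\<^sup>2 \<le> ?A / a\<^sup>2"
    using a2 by (intro divide_right_mono) auto
  then have "?B \<le> ?A / a\<^sup>2" using a2 by (simp add: add_divide_distrib)
  then have "?B powr (\<tau> - \<alpha>) \<le> (?A / a\<^sup>2) powr (\<tau> - \<alpha>)"
    using \<alpha>\<tau> by (intro powr_mono2) auto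
  also have "\<dots> = ?A powr (\<tau> - \<alpha>) * (a\<^sup>2) powr (\<alpha> - \<tau>)"
    using A a2 powr_minus_divide[of "a\<^sup>2" "\<tau> - \<alpha>"] by (simp add: powr_divide)
  finally have "?B powr (\<tau> - \<alpha>) * ?B powr \<alpha> \<le> ?A powr (\<tau> - \<alpha>) * (a\<^sup>2) powr (\<alpha> - \<tau>) * ?B powr \<alpha>"
    by (intro mult_right_mono) auto
  then show ?thesis by (simp flip: powr_add)
qed

text \<open>
  For \<open>\<bar>w\<bar> \<ge> 1\<close> the term \<open>\<theta>\<^sup>2 * \<bar>w\<bar>\<^sup>2\<close> alone already controls \<open>\<theta>\<^sup>2 * (1 + \<bar>w\<bar>\<^sup>2)\<close>. This is what
  separates the dependence on \<open>a\<close> and \<open>\<theta>\<close> from the dependence on \<open>w\<close>.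
\<close>

lemma rescaled_weight_le_high:
  fixes w :: "'a::real_normed_vector"
  assumes a: "0 < a" "a \<le> a\<^sub>0" and \<theta>: "0 < \<theta>" and \<tau>: "0 \<le> \<tau>" and \<sigma>: "0 \<le> \<sigma>" and w: "1 \<le> norm w"
  shows "(1 + (norm w)\<^sup>2 / a\<^sup>2) powr \<tau> * (1 + \<theta>\<^sup>2 * (norm w)\<^sup>2) powr (- 2 * \<sigma>)
    \<le> (a\<^sub>0\<^sup>2 + 1) powr \<tau> * (a\<^sup>2) powr (- \<tau>) * (2 powr (2 * \<sigma>) * (\<theta>\<^sup>2) powr (- 2 * \<sigma>))
      * (1 + (norm w)\<^sup>2) powr (- (2 * \<sigma> - \<tau>))"
proof -
  let ?A = "a\<^sub>0\<^sup>2 + 1" and ?B = "1 + (norm w)\<^sup>2 / a\<^sup>2" and ?n = "(norm w)\<^sup>2"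
  let ?G = "(1 + \<theta>\<^sup>2 * ?n) powr (- 2 * \<sigma>)"
  have a2: "0 < a\<^sup>2" "a\<^sup>2 \<le> a\<^sub>0\<^sup>2" using a by (auto intro: power_mono)
  have nw: "1 \<le> ?n" using w by (simp add: one_le_power)
  have "0 \<le> a\<^sub>0\<^sup>2 * ?n" by simp
  with a2 have "a\<^sup>2 + ?n \<le> ?A * (1 + ?n)"
    unfolding distrib_left distrib_right mult_1 mult_1_right by linarith
  then have "(a\<^sup>2 + ?n) / a\<^sup>2 \<le> ?A * (1 + ?n) / a\<^sup>2"
    using a2 by (intro divide_right_mono) auto
  then have "?B \<le> ?A * (1 + ?n) / a\<^sup>2" using a2 by (simp add: add_divide_distrib)
  then have "?B powr \<tau> \<le> (?A * (1 + ?n) / a\<^sup>2) powr \<tau>"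
    using \<tau> by (intro powr_mono2) auto
  also have "\<dots> = ?A powr \<tau> * (a\<^sup>2) powr (- \<tau>) * (1 + ?n) powr \<tau>"
    by (simp add: powr_divide powr_mult powr_minus_divide)
  finally have 1: "?B powr \<tau> \<le> ?A powr \<tau> * (a\<^sup>2) powr (- \<tau>) * (1 + ?n) powr \<tau>" .
  have "\<theta>\<^sup>2 * (1 + ?n) \<le> \<theta>\<^sup>2 * (2 * ?n)" using nw by (intro mult_left_mono) auto
  then have "\<theta>\<^sup>2 * (1 + ?n) / 2 \<le> 1 + \<theta>\<^sup>2 * ?n" by simp
  then have "?G \<le> (\<theta>\<^sup>2 * (1 + ?n) / 2) powr (- 2 * \<sigma>)"
    using \<theta> \<sigma> by (intro powr_mono2') (auto simp: add_pos_nonneg)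
  also have "\<dots> = 2 powr (2 * \<sigma>) * (\<theta>\<^sup>2) powr (- 2 * \<sigma>) * (1 + ?n) powr (- 2 * \<sigma>)"
    by (simp add: powr_divide powr_mult powr_minus_divide)
  finally have 2: "?G \<le> 2 powr (2 * \<sigma>) * (\<theta>\<^sup>2) powr (- 2 * \<sigma>) * (1 + ?n) powr (- 2 * \<sigma>)" .
  have "?B powr \<tau> * ?G \<le> (?A powr \<tau> * (a\<^sup>2) powr (- \<tau>) * (1 + ?n) powr \<tau>)
      * (2 powr (2 * \<sigma>) * (\<theta>\<^sup>2) powr (- 2 * \<sigma>) * (1 + ?n) powr (- 2 * \<sigma>))"
    by (intro mult_mono 1 2) auto
  also have "\<dots> = ?A powr \<tau> * (a\<^sup>2) powr (- \<tau>) * (2 powr (2 * \<sigma>) * (\<theta>\<^sup>2) powr (- 2 * \<sigma>))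
      * ((1 + ?n) powr \<tau> * (1 + ?n) powr (- 2 * \<sigma>))"
    by (simp only: mult_ac)
  also have "(1 + ?n) powr \<tau> * (1 + ?n) powr (- 2 * \<sigma>) = (1 + ?n) powr (- (2 * \<sigma> - \<tau>))"
    by (simp flip: powr_add)
  finally show ?thesis .
qed

text \<open>
  The matching lower bound has the same powers of \<open>a\<close> and \<open>\<theta>\<close>, with \<open>\<alpha>\<close> in place of \<open>\<tau>\<close>. The lower
  bound \<open>\<theta>\<^sub>0\<close> serves to absorb the summand 1 into \<open>\<theta>\<^sup>2\<close>.
\<close>

lemma rescaled_weight_ge_annulus:
  fixes w :: "'a::real_normed_vector"
  assumes a: "0 < a" and \<alpha>: "0 \<le> \<alpha>" and \<sigma>: "0 \<le> \<sigma>" and \<theta>\<^sub>0: "0 < \<theta>\<^sub>0" and \<theta>: "\<theta>\<^sub>0 \<le> \<theta>"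
    and w: "1 \<le> norm w" "norm w \<le> M"
  shows "(a\<^sup>2) powr (- \<alpha>) * ((\<theta>\<^sup>2) powr (- 2 * \<sigma>) * (1 / \<theta>\<^sub>0\<^sup>2 + M\<^sup>2) powr (- 2 * \<sigma>))
    \<le> (1 + (norm w)\<^sup>2 / a\<^sup>2) powr \<alpha> * (1 + \<theta>\<^sup>2 * (norm w)\<^sup>2) powr (- 2 * \<sigma>)"
proof (intro mult_mono)
  have a2: "0 < a\<^sup>2" using a by simp
  have nw: "1 \<le> (norm w)\<^sup>2" "(norm w)\<^sup>2 \<le> M\<^sup>2" using w by (auto simp: one_le_power intro: power_mono)
  have "1 / a\<^sup>2 \<le> (norm w)\<^sup>2 / a\<^sup>2" using nw a2 by (intro divide_right_mono) auto
  then have "(1 / a\<^sup>2) powr \<alpha> \<le> (1 + (norm w)\<^sup>2 / a\<^sup>2) powr \<alpha>"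
    using \<alpha> by (intro powr_mono2) auto
  then show "(a\<^sup>2) powr (- \<alpha>) \<le> (1 + (norm w)\<^sup>2 / a\<^sup>2) powr \<alpha>"
    by (simp add: powr_divide powr_minus_divide)
  have "1 \<le> \<theta>\<^sup>2 / \<theta>\<^sub>0\<^sup>2" using \<theta> \<theta>\<^sub>0 by (simp add: power_mono)
  moreover have "\<theta>\<^sup>2 * (norm w)\<^sup>2 \<le> \<theta>\<^sup>2 * M\<^sup>2" using nw by (intro mult_left_mono) auto
  ultimately have "1 + \<theta>\<^sup>2 * (norm w)\<^sup>2 \<le> \<theta>\<^sup>2 * (1 / \<theta>\<^sub>0\<^sup>2 + M\<^sup>2)" by (simp add: algebra_simps)
  then have "(\<theta>\<^sup>2 * (1 / \<theta>\<^sub>0\<^sup>2 + M\<^sup>2)) powr (- 2 * \<sigma>) \<le> (1 + \<theta>\<^sup>2 * (norm w)\<^sup>2) powr (- 2 * \<sigma>)"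
    using \<sigma> by (intro powr_mono2') (auto simp: add_pos_nonneg)
  then show "(\<theta>\<^sup>2) powr (- 2 * \<sigma>) * (1 / \<theta>\<^sub>0\<^sup>2 + M\<^sup>2) powr (- 2 * \<sigma>)
      \<le> (1 + \<theta>\<^sup>2 * (norm w)\<^sup>2) powr (- 2 * \<sigma>)"
    by (simp add: powr_mult)
qed auto

text \<open>
  This is the comparison after the frequencies have been rescaled so that the points are separated at
  unit scale: \<open>a\<close> stands for the separation distance divided by the dimension, and \<open>\<theta>\<close> for \<open>\<delta> / a\<close>, which is
  bounded below. Frequencies in the unit ball are handled by a pointwise comparison of the weights, the others
  by the upper and lower bounds for exponential sums. In the latter both sides carry the same power
  \<open>\<theta> powr (- 4 * \<sigma>)\<close>, and this makes the constant uniform in \<open>\<theta>\<close>.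
\<close>

lemma sobolev_weight_comparison_separated:
  fixes \<sigma> \<tau> \<alpha> a\<^sub>0 \<theta>\<^sub>0 :: real
  assumes \<sigma>: "DIM('a::euclidean_space) / 2 < \<sigma>" and \<alpha>: "0 \<le> \<alpha>" and \<alpha>\<tau>: "\<alpha> \<le> \<tau>" and \<tau>: "\<tau> \<le> \<sigma>"
    and \<theta>\<^sub>0: "0 < \<theta>\<^sub>0"
  shows "\<exists>C>0. \<forall>(X :: 'a set) c a \<theta>.
    finite X \<longrightarrow> box_separated X \<longrightarrow> 0 < a \<longrightarrow> a \<le> a\<^sub>0 \<longrightarrow> \<theta>\<^sub>0 \<le> \<theta> \<longrightarrow>
    (\<integral>\<^sup>+w. ennreal ((1 + (norm w)\<^sup>2 / a\<^sup>2) powr \<tau> * (1 + \<theta>\<^sup>2 * (norm w)\<^sup>2) powr (- 2 * \<sigma>)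
        * (cmod (expsum X c w))\<^sup>2) \<partial>lborel)
    \<le> ennreal (C * (a\<^sup>2) powr (\<alpha> - \<tau>)) *
      (\<integral>\<^sup>+w. ennreal ((1 + (norm w)\<^sup>2 / a\<^sup>2) powr \<alpha> * (1 + \<theta>\<^sup>2 * (norm w)\<^sup>2) powr (- 2 * \<sigma>)
        * (cmod (expsum X c w))\<^sup>2) \<partial>lborel)"
proof -
  have \<sigma>_pos: "0 < \<sigma>" by (rule le_less_trans[OF _ \<sigma>]) simp
  have \<tau>_nonneg: "0 \<le> \<tau>" using \<alpha> \<alpha>\<tau> by simp
  define \<kappa> where "\<kappa> = fejer_mass ^ DIM('a) / 2"
  have \<kappa>: "0 < \<kappa>" using fejer_mass_pos by (simp add: \<kappa>_def)
  have "DIM('a) / 2 < 2 * \<sigma> - \<tau>" using \<sigma> \<tau> by linarith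
  from nn_integral_bracket_expsum_le[OF this] obtain D where D: "0 < D"
    and upper: "\<And>(X :: 'a set) c. finite X \<Longrightarrow> box_separated X \<Longrightarrow>
      (\<integral>\<^sup>+w. ennreal ((1 + (norm w)\<^sup>2) powr (- (2 * \<sigma> - \<tau>)) * (cmod (expsum X c w))\<^sup>2) \<partial>lborel)
        \<le> ennreal (D * (\<Sum>x\<in>X. (cmod (c x))\<^sup>2))"
    by blast
  obtain R where R: "0 < R"
    and lower: "\<And>(X :: 'a set) c b. finite X \<Longrightarrow> box_separated X \<Longrightarrow>
      ennreal (\<kappa> * (\<Sum>x\<in>X. (cmod (c x))\<^sup>2))
        \<le> (\<integral>\<^sup>+w. indicator (cball b R) w * ennreal ((cmod (expsum X c w))\<^sup>2) \<partial>lborel)"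
    unfolding \<kappa>_def using expsum_ball_lower_bound by blast
  have [measurable]: "cball b R \<in> sets borel" for b :: 'a by simp
  define M where "M = 2 * R + 1"
  define L where "L = (1 / \<theta>\<^sub>0\<^sup>2 + M\<^sup>2) powr (- 2 * \<sigma>)"
  have "0 < 1 / \<theta>\<^sub>0\<^sup>2 + M\<^sup>2" using \<theta>\<^sub>0 by (simp add: add_pos_nonneg)
  then have L: "0 < L" unfolding L_def by simp
  define A where "A = a\<^sub>0\<^sup>2 + 1"
  have A: "1 \<le> A" by (simp add: A_def)
  define C\<^sub>1 where "C\<^sub>1 = A powr (\<tau> - \<alpha>)"
  define C\<^sub>2 where "C\<^sub>2 = A powr \<tau> * 2 powr (2 * \<sigma>) * D / (L * \<kappa>)"
  have C: "0 < C\<^sub>1" "0 < C\<^sub>2" using A D L \<kappa> by (auto simp: C\<^sub>1_def C\<^sub>2_def)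
  obtain e :: 'a where e: "e \<in> Basis" using nonempty_Basis by blast
  \<comment> \<open>The ball of radius \<open>R\<close> around \<open>b\<close> lies in the annulus \<open>1 \<le> \<bar>w\<bar> \<le> M\<close>. Staying away from the
    origin matters: there the weight of order \<open>\<alpha>\<close> is close to 1, not of size \<open>a powr (- 2 * \<alpha>)\<close>.\<close>
  define b where "b = (R + 1) *\<^sub>R e"
  have norm_b: "norm b = R + 1" using e R by (simp add: b_def)
  have "(\<integral>\<^sup>+w. ennreal ((1 + (norm w)\<^sup>2 / a\<^sup>2) powr \<tau> * (1 + \<theta>\<^sup>2 * (norm w)\<^sup>2) powr (- 2 * \<sigma>)
        * (cmod (expsum X c w))\<^sup>2) \<partial>lborel)
    \<le> ennreal ((C\<^sub>1 + C\<^sub>2) * (a\<^sup>2) powr (\<alpha> - \<tau>)) *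
      (\<integral>\<^sup>+w. ennreal ((1 + (norm w)\<^sup>2 / a\<^sup>2) powr \<alpha> * (1 + \<theta>\<^sup>2 * (norm w)\<^sup>2) powr (- 2 * \<sigma>)
        * (cmod (expsum X c w))\<^sup>2) \<partial>lborel)" (is "?J\<tau> \<le> _ * ?J\<alpha>")
    if X: "finite X" "box_separated X" and a: "0 < a" "a \<le> a\<^sub>0" and \<theta>: "\<theta>\<^sub>0 \<le> \<theta>"
    for X :: "'a set" and c a \<theta>
  proof -
    let ?P = "\<lambda>w. (cmod (expsum X c w))\<^sup>2" and ?S = "\<Sum>x\<in>X. (cmod (c x))\<^sup>2"
    let ?G = "\<lambda>w::'a. (1 + \<theta>\<^sup>2 * (norm w)\<^sup>2) powr (- 2 * \<sigma>)"
    let ?B = "\<lambda>w::'a. 1 + (norm w)\<^sup>2 / a\<^sup>2"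
    have S: "0 \<le> ?S" by (intro sum_nonneg) simp
    have \<theta>_pos: "0 < \<theta>" using \<theta> \<theta>\<^sub>0 by simp
    define m where "m = A powr \<tau> * (a\<^sup>2) powr (- \<tau>) * (2 powr (2 * \<sigma>) * (\<theta>\<^sup>2) powr (- 2 * \<sigma>))"
    have m: "0 \<le> m" by (simp add: m_def)
    have low: "?B w powr \<tau> \<le> C\<^sub>1 * (a\<^sup>2) powr (\<alpha> - \<tau>) * ?B w powr \<alpha>" if "norm w \<le> 1" for w :: 'a
      unfolding C\<^sub>1_def A_def using a \<alpha>\<tau> that by (rule rescaled_bracket_le_low)
    have high: "?B w powr \<tau> * ?G w \<le> m * (1 + (norm w)\<^sup>2) powr (- (2 * \<sigma> - \<tau>))" if "1 \<le> norm w" for w :: 'a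
      unfolding m_def A_def using a \<theta>_pos \<tau>_nonneg less_imp_le[OF \<sigma>_pos] that by (rule rescaled_weight_le_high)
    have annulus: "ennreal ((a\<^sup>2) powr (- \<alpha>) * ((\<theta>\<^sup>2) powr (- 2 * \<sigma>) * L) * (\<kappa> * ?S)) \<le> ?J\<alpha>"
    proof -
      let ?l = "(a\<^sup>2) powr (- \<alpha>) * ((\<theta>\<^sup>2) powr (- 2 * \<sigma>) * L)"
      have l: "0 \<le> ?l" using L by simp
      have pt: "?l \<le> ?B w powr \<alpha> * ?G w" if "w \<in> cball b R" for w
      proof -
        have "1 \<le> norm w" "norm w \<le> M"
          using that norm_b norm_triangle_ineq2[of b w] norm_triangle_ineq2[of w b]
          by (auto simp: dist_norm M_def norm_minus_commute)
        with a(1) \<alpha> less_imp_le[OF \<sigma>_pos] \<theta>\<^sub>0 \<theta> show ?thesis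
          unfolding L_def by (rule rescaled_weight_ge_annulus)
      qed
      have "ennreal (?l * (\<kappa> * ?S)) = ennreal ?l * ennreal (\<kappa> * ?S)"
        using l \<kappa> S by (simp add: ennreal_mult)
      also have "\<dots> \<le> ennreal ?l * (\<integral>\<^sup>+w. indicator (cball b R) w * ennreal (?P w) \<partial>lborel)"
        by (intro mult_left_mono lower X) simp
      also have "\<dots> = (\<integral>\<^sup>+w. ennreal ?l * (indicator (cball b R) w * ennreal (?P w)) \<partial>lborel)"
        by (rule nn_integral_cmult[symmetric]) measurable
      also have "\<dots> \<le> ?J\<alpha>"
      proof (rule nn_integral_mono)
        fix w
        show "ennreal ?l * (indicator (cball b R) w * ennreal (?P w)) \<le> ennreal (?B w powr \<alpha> * ?G w * ?P w)"
          using pt[of w] l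
          by (cases "w \<in> cball b R") (auto simp flip: ennreal_mult intro!: ennreal_leI mult_right_mono)
      qed
      finally show ?thesis .
    qed
    have "?J\<tau> \<le> (\<integral>\<^sup>+w. ennreal (C\<^sub>1 * (a\<^sup>2) powr (\<alpha> - \<tau>)) * ennreal (?B w powr \<alpha> * ?G w * ?P w)
        + ennreal m * ennreal ((1 + (norm w)\<^sup>2) powr (- (2 * \<sigma> - \<tau>)) * ?P w) \<partial>lborel)"
    proof (rule nn_integral_mono)
      fix w :: 'a
      let ?lo = "C\<^sub>1 * (a\<^sup>2) powr (\<alpha> - \<tau>) * (?B w powr \<alpha> * ?G w * ?P w)"
      let ?hi = "m * ((1 + (norm w)\<^sup>2) powr (- (2 * \<sigma> - \<tau>)) * ?P w)"
      have nonneg: "0 \<le> ?lo" "0 \<le> ?hi" using C m by auto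
      have "?B w powr \<tau> * ?G w * ?P w \<le> ?lo + ?hi"
      proof (cases "norm w \<le> 1")
        case True
        have "?B w powr \<tau> * (?G w * ?P w) \<le> C\<^sub>1 * (a\<^sup>2) powr (\<alpha> - \<tau>) * ?B w powr \<alpha> * (?G w * ?P w)"
          by (intro mult_right_mono low True) auto
        with nonneg(2) show ?thesis by (simp add: mult_ac)
      next
        case False
        then have "?B w powr \<tau> * ?G w * ?P w \<le> m * (1 + (norm w)\<^sup>2) powr (- (2 * \<sigma> - \<tau>)) * ?P w"
          by (intro mult_right_mono high) auto
        with nonneg(1) show ?thesis by (simp add: mult_ac)
      qed
      then have "ennreal (?B w powr \<tau> * ?G w * ?P w) \<le> ennreal ?lo + ennreal ?hi"
        using nonneg by (simp add: ennreal_leI flip: ennreal_plus)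
      then show "ennreal (?B w powr \<tau> * ?G w * ?P w)
          \<le> ennreal (C\<^sub>1 * (a\<^sup>2) powr (\<alpha> - \<tau>)) * ennreal (?B w powr \<alpha> * ?G w * ?P w)
            + ennreal m * ennreal ((1 + (norm w)\<^sup>2) powr (- (2 * \<sigma> - \<tau>)) * ?P w)"
        using C m by (simp flip: ennreal_mult)
    qed
    also have "\<dots> = ennreal (C\<^sub>1 * (a\<^sup>2) powr (\<alpha> - \<tau>)) * ?J\<alpha>
        + ennreal m * (\<integral>\<^sup>+w. ennreal ((1 + (norm w)\<^sup>2) powr (- (2 * \<sigma> - \<tau>)) * ?P w) \<partial>lborel)"
      by (subst nn_integral_add) (auto simp: nn_integral_cmult)
    also have "ennreal m * (\<integral>\<^sup>+w. ennreal ((1 + (norm w)\<^sup>2) powr (- (2 * \<sigma> - \<tau>)) * ?P w) \<partial>lborel)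
        \<le> ennreal m * ennreal (D * ?S)"
      by (intro mult_left_mono upper X) simp
    also have "\<dots> = ennreal (C\<^sub>2 * (a\<^sup>2) powr (\<alpha> - \<tau>))
        * ennreal ((a\<^sup>2) powr (- \<alpha>) * ((\<theta>\<^sup>2) powr (- 2 * \<sigma>) * L) * (\<kappa> * ?S))"
    proof -
      have split: "(a\<^sup>2) powr (- \<tau>) = (a\<^sup>2) powr (\<alpha> - \<tau>) * (a\<^sup>2) powr (- \<alpha>)"
        by (simp flip: powr_add)
      have "m * (D * ?S) = (C\<^sub>2 * (a\<^sup>2) powr (\<alpha> - \<tau>))
        * ((a\<^sup>2) powr (- \<alpha>) * ((\<theta>\<^sup>2) powr (- 2 * \<sigma>) * L) * (\<kappa> * ?S))"
        unfolding m_def C\<^sub>2_def split using L \<kappa> by (simp add: field_simps)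
      then show ?thesis
        using m D S C L \<kappa> by (simp flip: ennreal_mult)
    qed
    also have "\<dots> \<le> ennreal (C\<^sub>2 * (a\<^sup>2) powr (\<alpha> - \<tau>)) * ?J\<alpha>"
      by (intro mult_left_mono annulus) simp
    finally have "?J\<tau> \<le> ennreal (C\<^sub>1 * (a\<^sup>2) powr (\<alpha> - \<tau>)) * ?J\<alpha>
        + ennreal (C\<^sub>2 * (a\<^sup>2) powr (\<alpha> - \<tau>)) * ?J\<alpha>"
      by (simp add: add_left_mono)
    moreover have "ennreal ((C\<^sub>1 + C\<^sub>2) * (a\<^sup>2) powr (\<alpha> - \<tau>))
        = ennreal (C\<^sub>1 * (a\<^sup>2) powr (\<alpha> - \<tau>)) + ennreal (C\<^sub>2 * (a\<^sup>2) powr (\<alpha> - \<tau>))"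
      using C by (simp add: distrib_right)
    ultimately show ?thesis by (simp only: distrib_right)
  qed
  with C show ?thesis by (intro exI[of _ "C\<^sub>1 + C\<^sub>2"]) auto
qed

lemma expsum_scale:
  assumes "a \<noteq> 0"
  shows "expsum X c ((1 / a) *\<^sub>R w) = expsum ((\<lambda>x. (1 / a) *\<^sub>R x) ` X) (\<lambda>z. c (a *\<^sub>R z)) w"
  using assms unfolding expsum_def by (subst sum.reindex) (auto simp: inj_on_def)

text \<open>
  The substitution \<open>w = \<omega> / a\<close> with \<open>a = q / d\<close> reduces to unit separation. The factor \<open>1 / d\<close> accounts for
  the passage from the Euclidean norm to a single coordinate: the norm is at most the sum of the \<open>d\<close>
  absolute values of the coordinates.
\<close>

lemma sobolev_weight_comparison:
  fixes \<sigma> \<tau> \<alpha> c\<^sub>0 :: real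
  assumes \<sigma>: "DIM('a::euclidean_space) / 2 < \<sigma>" and \<alpha>: "0 \<le> \<alpha>" and \<alpha>\<tau>: "\<alpha> \<le> \<tau>" and \<tau>: "\<tau> \<le> \<sigma>"
    and c\<^sub>0: "0 < c\<^sub>0"
  shows "\<exists>C>0. \<forall>(X :: 'a set) c q \<delta>.
    finite X \<longrightarrow> (\<forall>x\<in>X. \<forall>y\<in>X. x \<noteq> y \<longrightarrow> 2 * q \<le> norm (x - y)) \<longrightarrow>
    0 < q \<longrightarrow> q \<le> c\<^sub>0 * \<delta> \<longrightarrow> 0 < \<delta> \<longrightarrow> \<delta> \<le> 1 \<longrightarrow>
    (\<integral>\<^sup>+w. ennreal ((1 + (norm w)\<^sup>2) powr \<tau> * (1 + \<delta>\<^sup>2 * (norm w)\<^sup>2) powr (- 2 * \<sigma>)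
        * (cmod (expsum X c w))\<^sup>2) \<partial>lborel)
    \<le> ennreal (C * (q powr (\<alpha> - \<tau>))\<^sup>2) *
      (\<integral>\<^sup>+w. ennreal ((1 + (norm w)\<^sup>2) powr \<alpha> * (1 + \<delta>\<^sup>2 * (norm w)\<^sup>2) powr (- 2 * \<sigma>)
        * (cmod (expsum X c w))\<^sup>2) \<partial>lborel)"
proof -
  let ?d = "real DIM('a)"
  have d: "0 < ?d" by simp
  obtain C where C: "0 < C" and comparison:
    "\<And>(X :: 'a set) c a \<theta>. finite X \<Longrightarrow> box_separated X \<Longrightarrow> 0 < a \<Longrightarrow> a \<le> c\<^sub>0 / ?d \<Longrightarrow> ?d / c\<^sub>0 \<le> \<theta> \<Longrightarrow>
    (\<integral>\<^sup>+w. ennreal ((1 + (norm w)\<^sup>2 / a\<^sup>2) powr \<tau> * (1 + \<theta>\<^sup>2 * (norm w)\<^sup>2) powr (- 2 * \<sigma>)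
        * (cmod (expsum X c w))\<^sup>2) \<partial>lborel)
    \<le> ennreal (C * (a\<^sup>2) powr (\<alpha> - \<tau>)) *
      (\<integral>\<^sup>+w. ennreal ((1 + (norm w)\<^sup>2 / a\<^sup>2) powr \<alpha> * (1 + \<theta>\<^sup>2 * (norm w)\<^sup>2) powr (- 2 * \<sigma>)
        * (cmod (expsum X c w))\<^sup>2) \<partial>lborel)"
    using sobolev_weight_comparison_separated
      [OF \<sigma> \<alpha> \<alpha>\<tau> \<tau> divide_pos_pos[OF d c\<^sub>0], where a\<^sub>0 = "c\<^sub>0 / ?d"] by blast
  define K where "K = C * (?d powr (\<tau> - \<alpha>))\<^sup>2"
  have K: "0 < K" using C by (simp add: K_def)
  let ?J = "\<lambda>s X c \<delta>. \<integral>\<^sup>+(w::'a). ennreal ((1 + (norm w)\<^sup>2) powr s * (1 + \<delta>\<^sup>2 * (norm w)\<^sup>2) powr (- 2 * \<sigma>)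
        * (cmod (expsum X c w))\<^sup>2) \<partial>lborel"
  have "?J \<tau> X c \<delta> \<le> ennreal (K * (q powr (\<alpha> - \<tau>))\<^sup>2) * ?J \<alpha> X c \<delta>"
    if X: "finite X" and sep: "\<And>x y. x \<in> X \<Longrightarrow> y \<in> X \<Longrightarrow> x \<noteq> y \<Longrightarrow> 2 * q \<le> norm (x - y)"
      and q: "0 < q" "q \<le> c\<^sub>0 * \<delta>" and \<delta>: "0 < \<delta>" "\<delta> \<le> 1" for X :: "'a set" and c q \<delta>
  proof -
    define a where "a = q / ?d"
    have a: "0 < a" using q d by (simp add: a_def)
    let ?Y = "(\<lambda>x. (1 / a) *\<^sub>R x) ` X" and ?c = "\<lambda>z. c (a *\<^sub>R z)"
    have Y: "box_separated ?Y"
      unfolding box_separated_def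
    proof (intro ballI impI)
      fix u v assume uv: "u \<in> ?Y" "v \<in> ?Y" "u \<noteq> v"
      then obtain x y where xy: "x \<in> X" "y \<in> X" "x \<noteq> y"
        and u: "u = (1 / a) *\<^sub>R x" and v: "v = (1 / a) *\<^sub>R y" by blast
      show "\<exists>b\<in>Basis. 2 \<le> \<bar>(u - v) \<bullet> b\<bar>"
      proof (rule ccontr)
        assume small: "\<not> ?thesis"
        have "2 * q \<le> norm (x - y)" using xy by (rule sep)
        also have "\<dots> \<le> (\<Sum>b\<in>Basis. \<bar>(x - y) \<bullet> b\<bar>)" by (rule norm_le_l1)
        also have "\<dots> < (\<Sum>b\<in>(Basis :: 'a set). 2 * a)"
        proof (rule sum_strict_mono)
          fix b :: 'a assume "b \<in> Basis"
          with small have "\<bar>(u - v) \<bullet> b\<bar> < 2" by (meson not_le)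
          moreover have "(x - y) \<bullet> b = a * ((u - v) \<bullet> b)"
            using a by (simp add: u v inner_diff_left right_diff_distrib)
          ultimately show "\<bar>(x - y) \<bullet> b\<bar> < 2 * a" using a by (simp add: abs_mult)
        qed auto
        also have "\<dots> = 2 * q" by (simp add: a_def)
        finally show False by simp
      qed
    qed
    have rescale: "?J s X c \<delta> = ennreal ((1 / a) ^ DIM('a)) *
      (\<integral>\<^sup>+w. ennreal ((1 + (norm w)\<^sup>2 / a\<^sup>2) powr s * (1 + (\<delta> / a)\<^sup>2 * (norm w)\<^sup>2) powr (- 2 * \<sigma>)
        * (cmod (expsum ?Y ?c w))\<^sup>2) \<partial>lborel)" for s
      using a by (subst nn_integral_lborel_scale[of _ "1 / a"])
        (simp_all add: expsum_scale power_mult_distrib power_divide)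
    have "c\<^sub>0 * \<delta> \<le> c\<^sub>0" using \<delta> c\<^sub>0 by (intro mult_left_le) auto
    then have "a \<le> c\<^sub>0 / ?d"
      unfolding a_def using q(2) d by (intro divide_right_mono) auto
    moreover have "?d / c\<^sub>0 \<le> \<delta> / a"
      using q c\<^sub>0 by (simp add: a_def field_simps)
    ultimately have le: "?J \<tau> X c \<delta> \<le> ennreal (C * (a\<^sup>2) powr (\<alpha> - \<tau>)) * ?J \<alpha> X c \<delta>"
      unfolding rescale using comparison[of ?Y a "\<delta> / a" ?c] X Y a
      by (simp add: mult.left_commute mult_left_mono)
    have "(a\<^sup>2) powr (\<alpha> - \<tau>) = (a powr (\<alpha> - \<tau>))\<^sup>2"
      using a by (simp add: powr_powr mult.commute flip: powr_numeral)
    also have "a powr (\<alpha> - \<tau>) = ?d powr (\<tau> - \<alpha>) * q powr (\<alpha> - \<tau>)"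
      using q d powr_minus_divide[of ?d "\<tau> - \<alpha>"] by (simp add: a_def powr_divide powr_diff)
    finally have "C * (a\<^sup>2) powr (\<alpha> - \<tau>) = K * (q powr (\<alpha> - \<tau>))\<^sup>2"
      by (simp add: K_def power_mult_distrib)
    with le show ?thesis by simp
  qed
  with K show ?thesis by (intro exI[of _ K]) blast
qed

section \<open>Fourier transforms of kernel translates\<close>

lemma has_bochner_integral_lborel_affine:
  fixes g :: "'a::euclidean_space \<Rightarrow> 'b::{banach,second_countable_topology}"
  assumes c: "0 < c" and g: "has_bochner_integral lborel g I"
  shows "has_bochner_integral lborel (\<lambda>x. g ((x - t) /\<^sub>R c)) (c ^ DIM('a) *\<^sub>R I)"
proof -
  have [measurable]: "g \<in> borel_measurable borel"
    using g by (auto simp: has_bochner_integral_iff)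
  have g_eq: "g ((t + c *\<^sub>R x - t) /\<^sub>R c) = g x" for x using c by simp
  have "has_bochner_integral (distr lborel borel (\<lambda>x. t + c *\<^sub>R x))
      (\<lambda>x. (c ^ DIM('a)) *\<^sub>R g ((x - t) /\<^sub>R c)) (c ^ DIM('a) *\<^sub>R I)"
    using g by (intro has_bochner_integral_distr)
      (auto simp only: g_eq intro!: has_bochner_integral_scaleR_right, measurable)
  then have "has_bochner_integral (density (distr lborel borel (\<lambda>x. t + c *\<^sub>R x)) (\<lambda>_. c ^ DIM('a)))
      (\<lambda>x. g ((x - t) /\<^sub>R c)) (c ^ DIM('a) *\<^sub>R I)"
    using c by (intro has_bochner_integral_density) auto
  then show ?thesis
    using c lborel_affine[of c t] by simp
qed

text \<open>
  The factor \<open>\<delta> ^ (- d)\<close> in the scaled kernel cancels against the Jacobian of \<open>x \<mapsto> y + \<delta> x\<close>.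
\<close>

lemma fourier_translate_span:
  fixes \<Phi> :: "real ^ 'n \<Rightarrow> real"
  assumes \<Phi>: "integrable lborel \<Phi>" and \<delta>: "0 < \<delta>"
  shows "fourier (\<lambda>x. complex_of_real (\<Sum>y\<in>X. c y * scaled_kernel \<delta> \<Phi> (x - y))) \<omega>
    = fourier (\<lambda>x. complex_of_real (\<Phi> x)) (\<delta> *\<^sub>R \<omega>) * expsum X (\<lambda>y. complex_of_real (c y)) \<omega>"
proof -
  let ?v = "\<lambda>x. complex_of_real (\<Sum>y\<in>X. c y * scaled_kernel \<delta> \<Phi> (x - y))"
  let ?e = "\<lambda>x w. exp (- (\<i> * complex_of_real (x \<bullet> w)))"
  let ?I = "\<lambda>w. LINT x|lborel. complex_of_real (\<Phi> x) * ?e x w"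
  have e: "?e x w = cis (- (x \<bullet> w))" for x w :: "real ^ 'n"
    by (simp add: cis_conv_exp)
  have transform: "has_bochner_integral lborel (\<lambda>x. ?v x * ?e x w)
      (\<Sum>y\<in>X. complex_of_real (c y) * cis (- (y \<bullet> w)) * ?I (\<delta> *\<^sub>R w))" for w
  proof -
    let ?g = "\<lambda>x. complex_of_real (\<Phi> x) * ?e x (\<delta> *\<^sub>R w)"
    have "integrable lborel ?g"
    proof (rule Bochner_Integration.integrable_bound[OF \<Phi>])
      show "?g \<in> borel_measurable lborel"
        using borel_measurable_integrable[OF \<Phi>] by measurable
    qed (simp add: e norm_mult)
    then have g: "has_bochner_integral lborel ?g (?I (\<delta> *\<^sub>R w))"
      by (rule has_bochner_integral_integrable)
    have "has_bochner_integral lborel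
        (\<lambda>x. \<Sum>y\<in>X. complex_of_real (c y) * cis (- (y \<bullet> w)) * (of_real (1 / \<delta> ^ CARD('n)) * ?g ((x - y) /\<^sub>R \<delta>)))
        (\<Sum>y\<in>X. complex_of_real (c y) * cis (- (y \<bullet> w)) *
          (of_real (1 / \<delta> ^ CARD('n)) * (\<delta> ^ DIM(real ^ 'n) *\<^sub>R ?I (\<delta> *\<^sub>R w))))"
      by (intro has_bochner_integral_sum has_bochner_integral_mult_right
          has_bochner_integral_lborel_affine \<delta> g)
    also have "(\<lambda>x. \<Sum>y\<in>X. complex_of_real (c y) * cis (- (y \<bullet> w)) * (of_real (1 / \<delta> ^ CARD('n)) * ?g ((x - y) /\<^sub>R \<delta>)))
        = (\<lambda>x. ?v x * ?e x w)"
    proof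
      fix x :: "real ^ 'n"
      have phase: "cis (- (y \<bullet> w)) * ?e ((x - y) /\<^sub>R \<delta>) (\<delta> *\<^sub>R w) = ?e x w" for y
      proof -
        have "((x - y) /\<^sub>R \<delta>) \<bullet> (\<delta> *\<^sub>R w) = x \<bullet> w - y \<bullet> w"
          using \<delta> by (simp add: inner_diff_left)
        then have "?e ((x - y) /\<^sub>R \<delta>) (\<delta> *\<^sub>R w) = cis (- (x \<bullet> w - y \<bullet> w))"
          unfolding e by (rule arg_cong)
        then show ?thesis by (simp only: e cis_mult) simp
      qed
      have "complex_of_real (c y) * cis (- (y \<bullet> w)) * (of_real (1 / \<delta> ^ CARD('n)) * ?g ((x - y) /\<^sub>R \<delta>))
          = complex_of_real (c y * scaled_kernel \<delta> \<Phi> (x - y)) * ?e x w" for y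
        unfolding phase[of y, symmetric] by (simp add: scaled_kernel_def)
      then show "(\<Sum>y\<in>X. complex_of_real (c y) * cis (- (y \<bullet> w)) * (of_real (1 / \<delta> ^ CARD('n)) * ?g ((x - y) /\<^sub>R \<delta>)))
          = ?v x * ?e x w"
        by (simp add: sum_distrib_right)
    qed
    finally show ?thesis using \<delta> by (simp add: scaleR_conv_of_real)
  qed
  \<comment> \<open>At frequency 0 the exponential factor is 1. Integrability selects the integral in the definition
    of the transform.\<close>
  have "integrable lborel ?v"
    using transform[of 0] by (simp add: has_bochner_integral_iff)
  moreover have "integrable lborel (\<lambda>x. complex_of_real (\<Phi> x))" using \<Phi> by simp
  moreover have "(LINT x|lborel. ?v x * ?e x \<omega>) = ?I (\<delta> *\<^sub>R \<omega>) * expsum X (\<lambda>y. complex_of_real (c y)) \<omega>"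
    unfolding expsum_def sum_distrib_left has_bochner_integral_integral_eq[OF transform]
    by (intro sum.cong refl) (simp only: mult_ac)
  ultimately show ?thesis
    by (simp add: fourier_def fourier_integral_def)
qed

section \<open>The inverse inequality\<close>

lemma separation_distance_properties:
  fixes X :: "(real ^ 'n) set"
  assumes X: "finite X" "2 \<le> card X"
  shows "0 < separation_distance X"
    and "\<And>x y. x \<in> X \<Longrightarrow> y \<in> X \<Longrightarrow> x \<noteq> y \<Longrightarrow> 2 * separation_distance X \<le> norm (x - y)"
proof -
  let ?D = "{norm (x - y) |x y. x \<in> X \<and> y \<in> X \<and> x \<noteq> y}"
  have "?D \<subseteq> (\<lambda>(x, y). norm (x - y)) ` (X \<times> X)" by auto
  then have fin: "finite ?D" using X(1) by (meson finite_SigmaI finite_imageI finite_subset)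
  have "\<not> card X \<le> Suc 0" using X(2) by simp
  then obtain x y where "x \<in> X" "y \<in> X" "x \<noteq> y"
    unfolding card_le_Suc0_iff_eq[OF X(1)] by blast
  then have "?D \<noteq> {}" by blast
  then have "Min ?D \<in> ?D" by (rule Min_in[OF fin])
  then show "0 < separation_distance X" by (auto simp: separation_distance_def)
  fix x y assume "x \<in> X" "y \<in> X" "x \<noteq> y"
  then have "norm (x - y) \<in> ?D" by blast
  then have "Min ?D \<le> norm (x - y)" by (rule Min_le[OF fin])
  then show "2 * separation_distance X \<le> norm (x - y)" by (simp add: separation_distance_def)
qed

lemma ennreal_sqrt_mono: "s \<le> t \<Longrightarrow> ennreal_sqrt s \<le> ennreal_sqrt t"
  unfolding ennreal_sqrt_def by (auto simp: top_unique less_top intro!: ennreal_leI enn2real_mono)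

lemma ennreal_sqrt_mult_square:
  assumes "0 < k"
  shows "ennreal_sqrt (ennreal (k\<^sup>2) * t) = ennreal k * ennreal_sqrt t"
proof (cases t rule: ennreal_cases)
  case (real r)
  with assms show ?thesis
    by (simp add: ennreal_sqrt_def real_sqrt_mult flip: ennreal_mult)
next
  case top
  with assms show ?thesis by (simp add: ennreal_sqrt_def ennreal_mult_top)
qed

text \<open>
  Only the modulus of the Fourier transform of the kernel enters the Sobolev norms, so the two-sided
  bound is assumed for the modulus. It is applied at \<open>\<delta> \<omega>\<close> and allows to replace the transform by the
  explicit weight; the constant picks up the factor \<open>C\<^sub>\<Phi> / c\<^sub>\<Phi>\<close>.
\<close>

lemma inverse_inequality_translate_span:
  fixes \<Phi> :: "real ^ 'n \<Rightarrow> real"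
    and \<sigma> c\<^sub>\<Phi> C\<^sub>\<Phi> c\<^sub>0 \<alpha> \<tau> :: real
  assumes \<Phi>: "integrable lborel \<Phi>"
    and \<sigma>: "real CARD('n) / 2 < \<sigma>"
    and c\<^sub>\<Phi>: "0 < c\<^sub>\<Phi>" and C\<^sub>\<Phi>: "0 < C\<^sub>\<Phi>"
    and hat_ge: "\<And>\<omega>. c\<^sub>\<Phi> * (1 + (norm \<omega>)\<^sup>2) powr (- \<sigma>) \<le> cmod (fourier (\<lambda>x. complex_of_real (\<Phi> x)) \<omega>)"
    and hat_le: "\<And>\<omega>. cmod (fourier (\<lambda>x. complex_of_real (\<Phi> x)) \<omega>) \<le> C\<^sub>\<Phi> * (1 + (norm \<omega>)\<^sup>2) powr (- \<sigma>)"
    and c\<^sub>0: "0 < c\<^sub>0"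
    and \<alpha>: "0 \<le> \<alpha>" and \<alpha>\<tau>: "\<alpha> \<le> \<tau>" and \<tau>: "\<tau> \<le> \<sigma>"
  shows "\<exists>C>0. \<forall>\<delta> X v.
           0 < \<delta> \<and> \<delta> \<le> 1 \<and> finite X \<and> 2 \<le> card X \<and>
           separation_distance X \<le> c\<^sub>0 * \<delta> \<and>
           v \<in> translate_span (scaled_kernel \<delta> \<Phi>) X \<longrightarrow>
           sobolev_norm \<tau> (\<lambda>x. complex_of_real (v x))
             \<le> ennreal (C * separation_distance X powr (\<alpha> - \<tau>)) *
               sobolev_norm \<alpha> (\<lambda>x. complex_of_real (v x))"
proof -
  \<comment> \<open>\<open>?N\<close> is the integral in the Sobolev norm; \<open>?J\<close> has the transform of the kernel replaced by
    its two-sided bound, which makes the integrand manifestly measurable.\<close>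
  let ?F = "fourier (\<lambda>x. complex_of_real (\<Phi> x))"
  let ?N = "\<lambda>s w. \<integral>\<^sup>+\<omega>. ennreal ((1 + (norm \<omega>)\<^sup>2) powr s * (cmod (fourier w \<omega>))\<^sup>2) \<partial>lborel"
  let ?J = "\<lambda>s X c \<delta>. \<integral>\<^sup>+(w::real^'n). ennreal ((1 + (norm w)\<^sup>2) powr s * (1 + \<delta>\<^sup>2 * (norm w)\<^sup>2) powr (- 2 * \<sigma>)
        * (cmod (expsum X c w))\<^sup>2) \<partial>lborel"
  have square: "(k * (1 + (norm \<omega>)\<^sup>2) powr (- \<sigma>))\<^sup>2 = k\<^sup>2 * (1 + (norm \<omega>)\<^sup>2) powr (- 2 * \<sigma>)"
    for k and \<omega> :: "real ^ 'n"
    by (simp add: power_mult_distrib power2_eq_square flip: powr_add)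
  have F_ge: "c\<^sub>\<Phi>\<^sup>2 * (1 + (norm \<omega>)\<^sup>2) powr (- 2 * \<sigma>) \<le> (cmod (?F \<omega>))\<^sup>2" for \<omega>
    unfolding square[symmetric] using c\<^sub>\<Phi> hat_ge by (intro power_mono) auto
  have F_le: "(cmod (?F \<omega>))\<^sup>2 \<le> C\<^sub>\<Phi>\<^sup>2 * (1 + (norm \<omega>)\<^sup>2) powr (- 2 * \<sigma>)" for \<omega>
    unfolding square[symmetric] using hat_le by (intro power_mono) auto
  have dim: "DIM(real ^ 'n) / 2 < \<sigma>" using \<sigma> by simp
  obtain C where C: "0 < C" and comparison:
    "\<And>(X :: (real ^ 'n) set) c q \<delta>. finite X \<Longrightarrow> (\<forall>x\<in>X. \<forall>y\<in>X. x \<noteq> y \<longrightarrow> 2 * q \<le> norm (x - y)) \<Longrightarrow>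
      0 < q \<Longrightarrow> q \<le> c\<^sub>0 * \<delta> \<Longrightarrow> 0 < \<delta> \<Longrightarrow> \<delta> \<le> 1 \<Longrightarrow>
      ?J \<tau> X c \<delta> \<le> ennreal (C * (q powr (\<alpha> - \<tau>))\<^sup>2) * ?J \<alpha> X c \<delta>"
    using sobolev_weight_comparison[OF dim \<alpha> \<alpha>\<tau> \<tau> c\<^sub>0] by blast
  define K where "K = C\<^sub>\<Phi> / c\<^sub>\<Phi> * sqrt C"
  have K: "0 < K" using C C\<^sub>\<Phi> c\<^sub>\<Phi> by (simp add: K_def)
  have "sobolev_norm \<tau> (\<lambda>x. complex_of_real (v x))
      \<le> ennreal (K * separation_distance X powr (\<alpha> - \<tau>)) * sobolev_norm \<alpha> (\<lambda>x. complex_of_real (v x))"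
    if \<delta>: "0 < \<delta>" "\<delta> \<le> 1" and X: "finite X" "2 \<le> card X" and q: "separation_distance X \<le> c\<^sub>0 * \<delta>"
      and v: "v \<in> translate_span (scaled_kernel \<delta> \<Phi>) X" for \<delta> X v
  proof -
    let ?q = "separation_distance X" and ?w = "\<lambda>x. complex_of_real (v x)"
    note sep = separation_distance_properties[OF X]
    obtain c where "v = (\<lambda>x. \<Sum>y\<in>X. c y * scaled_kernel \<delta> \<Phi> (x - y))"
      using v by (auto simp: translate_span_def)
    then have hat: "fourier ?w \<omega> = ?F (\<delta> *\<^sub>R \<omega>) * expsum X (\<lambda>y. complex_of_real (c y)) \<omega>" for \<omega>
      by (simp only: fourier_translate_span[OF \<Phi> \<delta>(1)])
    let ?c = "\<lambda>y. complex_of_real (c y)"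
    let ?j = "\<lambda>s w. (1 + (norm w)\<^sup>2) powr s * (1 + \<delta>\<^sup>2 * (norm w)\<^sup>2) powr (- 2 * \<sigma>) * (cmod (expsum X ?c w))\<^sup>2"
    have N_eq: "?N s ?w = (\<integral>\<^sup>+\<omega>. ennreal ((1 + (norm \<omega>)\<^sup>2) powr s * ((cmod (?F (\<delta> *\<^sub>R \<omega>)))\<^sup>2 * (cmod (expsum X ?c \<omega>))\<^sup>2)) \<partial>lborel)" for s
      by (simp add: hat norm_mult power_mult_distrib)
    have norm_\<delta>: "(norm (\<delta> *\<^sub>R \<omega>))\<^sup>2 = \<delta>\<^sup>2 * (norm \<omega>)\<^sup>2" for \<omega> :: "real ^ 'n"
      by (simp add: power_mult_distrib)
    have N_le: "?N s ?w \<le> ennreal (C\<^sub>\<Phi>\<^sup>2) * ?J s X ?c \<delta>" for s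
    proof -
      have "?N s ?w \<le> (\<integral>\<^sup>+\<omega>. ennreal (C\<^sub>\<Phi>\<^sup>2) * ennreal (?j s \<omega>) \<partial>lborel)"
        unfolding N_eq
      proof (rule nn_integral_mono)
        fix \<omega> :: "real ^ 'n"
        have "(1 + (norm \<omega>)\<^sup>2) powr s * ((cmod (?F (\<delta> *\<^sub>R \<omega>)))\<^sup>2 * (cmod (expsum X ?c \<omega>))\<^sup>2)
            \<le> (1 + (norm \<omega>)\<^sup>2) powr s * ((C\<^sub>\<Phi>\<^sup>2 * (1 + \<delta>\<^sup>2 * (norm \<omega>)\<^sup>2) powr (- 2 * \<sigma>)) * (cmod (expsum X ?c \<omega>))\<^sup>2)"
          using F_le[of "\<delta> *\<^sub>R \<omega>"] unfolding norm_\<delta> by (intro mult_left_mono mult_right_mono) auto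
        also have "\<dots> = C\<^sub>\<Phi>\<^sup>2 * ?j s \<omega>" by (simp add: mult_ac)
        finally show "ennreal ((1 + (norm \<omega>)\<^sup>2) powr s * ((cmod (?F (\<delta> *\<^sub>R \<omega>)))\<^sup>2 * (cmod (expsum X ?c \<omega>))\<^sup>2))
            \<le> ennreal (C\<^sub>\<Phi>\<^sup>2) * ennreal (?j s \<omega>)"
          by (simp add: ennreal_leI flip: ennreal_mult)
      qed
      also have "\<dots> = ennreal (C\<^sub>\<Phi>\<^sup>2) * ?J s X ?c \<delta>"
        by (rule nn_integral_cmult) measurable
      finally show ?thesis .
    qed
    have N_ge: "ennreal (c\<^sub>\<Phi>\<^sup>2) * ?J s X ?c \<delta> \<le> ?N s ?w" for s
    proof -
      have "ennreal (c\<^sub>\<Phi>\<^sup>2) * ?J s X ?c \<delta> = (\<integral>\<^sup>+\<omega>. ennreal (c\<^sub>\<Phi>\<^sup>2) * ennreal (?j s \<omega>) \<partial>lborel)"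
        by (rule nn_integral_cmult[symmetric]) measurable
      also have "\<dots> \<le> ?N s ?w"
        unfolding N_eq
      proof (rule nn_integral_mono)
        fix \<omega> :: "real ^ 'n"
        have "c\<^sub>\<Phi>\<^sup>2 * ?j s \<omega> = (1 + (norm \<omega>)\<^sup>2) powr s * ((c\<^sub>\<Phi>\<^sup>2 * (1 + \<delta>\<^sup>2 * (norm \<omega>)\<^sup>2) powr (- 2 * \<sigma>)) * (cmod (expsum X ?c \<omega>))\<^sup>2)"
          by (simp add: mult_ac)
        also have "\<dots> \<le> (1 + (norm \<omega>)\<^sup>2) powr s * ((cmod (?F (\<delta> *\<^sub>R \<omega>)))\<^sup>2 * (cmod (expsum X ?c \<omega>))\<^sup>2)"
          using F_ge[of "\<delta> *\<^sub>R \<omega>"] unfolding norm_\<delta> by (intro mult_left_mono mult_right_mono) auto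
        finally show "ennreal (c\<^sub>\<Phi>\<^sup>2) * ennreal (?j s \<omega>)
            \<le> ennreal ((1 + (norm \<omega>)\<^sup>2) powr s * ((cmod (?F (\<delta> *\<^sub>R \<omega>)))\<^sup>2 * (cmod (expsum X ?c \<omega>))\<^sup>2))"
          by (simp add: ennreal_leI flip: ennreal_mult)
      qed
      finally show ?thesis .
    qed
    let ?k = "K * ?q powr (\<alpha> - \<tau>)"
    have k: "0 < ?k" using K sep(1) by simp
    have k2: "?k\<^sup>2 * c\<^sub>\<Phi>\<^sup>2 = C\<^sub>\<Phi>\<^sup>2 * (C * (?q powr (\<alpha> - \<tau>))\<^sup>2)"
      using c\<^sub>\<Phi> C by (simp add: K_def power_mult_distrib power_divide)
    have "?N \<tau> ?w \<le> ennreal (C\<^sub>\<Phi>\<^sup>2) * (ennreal (C * (?q powr (\<alpha> - \<tau>))\<^sup>2) * ?J \<alpha> X ?c \<delta>)"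
      by (rule order_trans[OF N_le mult_left_mono[OF comparison[OF X(1)]]])
        (use sep q \<delta> in auto)
    also have "\<dots> = ennreal (C\<^sub>\<Phi>\<^sup>2 * (C * (?q powr (\<alpha> - \<tau>))\<^sup>2)) * ?J \<alpha> X ?c \<delta>"
      using C by (simp add: ennreal_mult mult.assoc)
    also have "\<dots> = ennreal (?k\<^sup>2) * (ennreal (c\<^sub>\<Phi>\<^sup>2) * ?J \<alpha> X ?c \<delta>)"
      unfolding k2[symmetric] by (simp add: ennreal_mult mult.assoc)
    also have "\<dots> \<le> ennreal (?k\<^sup>2) * ?N \<alpha> ?w"
      by (intro mult_left_mono N_ge) simp
    finally have "ennreal ((2 * pi) powr (- real CARD('n) / 2)) * ?N \<tau> ?w
        \<le> ennreal (?k\<^sup>2) * (ennreal ((2 * pi) powr (- real CARD('n) / 2)) * ?N \<alpha> ?w)"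
      by (subst mult.left_commute) (rule mult_left_mono, simp_all)
    from ennreal_sqrt_mono[OF this] show ?thesis
      unfolding sobolev_norm_def ennreal_sqrt_mult_square[OF k] .
  qed
  with K show ?thesis by (intro exI[of _ K]) blast
qed

theorem theorem4p2:
  fixes \<Phi> :: "real ^ 'n \<Rightarrow> real"
    and \<sigma> c\<^sub>\<Phi> C\<^sub>\<Phi> c\<^sub>0 \<alpha> \<tau> :: real
  assumes "continuous_on UNIV \<Phi>"
    and "integrable lborel \<Phi>"
    and "strictly_positive_definite \<Phi>"
    and "real CARD('n) / 2 < \<sigma>"
    and "0 < c\<^sub>\<Phi>" and "c\<^sub>\<Phi> \<le> C\<^sub>\<Phi>"
    and "\<And>\<omega>. fourier (\<lambda>x. complex_of_real (\<Phi> x)) \<omega> \<in> \<real>"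
    and "\<And>\<omega>. c\<^sub>\<Phi> * (1 + (norm \<omega>)\<^sup>2) powr (- \<sigma>) \<le> Re (fourier (\<lambda>x. complex_of_real (\<Phi> x)) \<omega>)"
    and "\<And>\<omega>. Re (fourier (\<lambda>x. complex_of_real (\<Phi> x)) \<omega>) \<le> C\<^sub>\<Phi> * (1 + (norm \<omega>)\<^sup>2) powr (- \<sigma>)"
    and "0 < c\<^sub>0"
    and "0 \<le> \<alpha>" and "\<alpha> \<le> \<tau>" and "\<tau> \<le> \<sigma>"
  shows "\<exists>C>0. \<forall>\<delta> X v.
           0 < \<delta> \<and> \<delta> \<le> 1 \<and> finite X \<and> 2 \<le> card X \<and>
           separation_distance X \<le> c\<^sub>0 * \<delta> \<and>
           v \<in> translate_span (scaled_kernel \<delta> \<Phi>) X \<longrightarrow>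
           sobolev_norm \<tau> (\<lambda>x. complex_of_real (v x))
             \<le> ennreal (C * separation_distance X powr (\<alpha> - \<tau>)) *
               sobolev_norm \<alpha> (\<lambda>x. complex_of_real (v x))"
proof -
  let ?F = "fourier (\<lambda>x. complex_of_real (\<Phi> x))"
  \<comment> \<open>a real number bounded below by a positive one is its own modulus\<close>
  have modulus: "cmod (?F \<omega>) = Re (?F \<omega>)" for \<omega>
  proof -
    have "0 \<le> c\<^sub>\<Phi> * (1 + (norm \<omega>)\<^sup>2) powr (- \<sigma>)" using assms(5) by simp
    then have "0 \<le> Re (?F \<omega>)" using assms(8)[of \<omega>] by linarith
    moreover have "?F \<omega> = complex_of_real (Re (?F \<omega>))"
      using assms(7)[of \<omega>] by (simp add: of_real_Re)
    ultimately show ?thesis by (metis norm_of_real abs_of_nonneg)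
  qed
  have "0 < C\<^sub>\<Phi>" using assms(5,6) by simp
  with assms show ?thesis
    by (intro inverse_inequality_translate_span[of \<Phi> \<sigma> c\<^sub>\<Phi> C\<^sub>\<Phi> c\<^sub>0 \<alpha> \<tau>]) (simp_all only: modulus)
qed

end
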